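(* For every even $d\ge 2$ and every $n\ge1$, $$\det_d(\mathsf M^{(d)}_n)=\pm\left(\prod_{i=0}^{n-1}\frac{(n+i)!}{i!}\right)^{\frac d2-1}.$$
   Context: For an $n\times n$ matrix $X=(X_{ij})$, the shifted iterated matrix multiplication tensor $\mathsf M^{(d)}_X$ is the hypermatrix with $d$ modes, each indexed by pairs $(i,j)\in[n]^2$, with entries $(\mathsf M^{(d)}_X)_{(i_1,j_1),\dots,(i_d,j_d)}=\delta_{j_1=i_2}\delta_{j_2=i_3}\cdots\delta_{j_{d-1}=i_d}\,X_{i_1j_d}$ (equivalently, as a multilinear form on $d$-tuples of $n\times n$ matrices, $(A_1,\dots,A_d)\mapsto\mathrm{Tr}(X^tA_1\cdots A_d)$). Set $\mathsf M^{(d)}_n:=\mathsf M^{(d)}_{I_n}$. For a hypermatrix $X$ with $d$ modes each indexed by an $N$-element set (identified with $[N]$ by a fixed bijection, the same in all modes), the combinatorial hyperdeterminant is $\det_d(X)=\frac1{N!}\sum_{\sigma_1,\dots,\sigma_d\in S_N}\mathrm{sgn}(\sigma_1)\cdots\mathrm{sgn}(\sigma_d)\prod_{i=1}^N X_{\sigma_1(i),\dots,\sigma_d(i)}$. *)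

theory Defs
  imports "Jordan_Normal_Form.Matrix" "HOL-Combinatorics.Permutations"
begin

text \<open>
  A hypermatrix with \<open>d\<close> modes, each indexed by a set \<open>I\<close>, is a function on
  \<open>{1..d} \<rightarrow>\<^sub>E I\<close>: the multi-index \<open>(p\<^sub>1, \<dots>, p\<^sub>d)\<close> is the function \<open>k \<mapsto> p\<^sub>k\<close>.
  Modes are numbered from 1; rows and columns of matrices, and hence all index sets \<open>[n]\<close>
  and \<open>[N]\<close>, are numbered from 0, following the matrix library.
\<close>

type_synonym ('i, 'a) hypermatrix = "(nat \<Rightarrow> 'i) \<Rightarrow> 'a"

text \<open>The bijection \<open>b\<close> identifies \<open>{0..<N}\<close> with the index set of each mode.\<close>

definition hyperdet ::
  "nat \<Rightarrow> nat \<Rightarrow> (nat \<Rightarrow> 'i) \<Rightarrow> ('i, 'a :: field_char_0) hypermatrix \<Rightarrow> 'a" where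
  "hyperdet d N b X =
     1 / fact N *
     (\<Sum>\<sigma> \<in> {1..d} \<rightarrow>\<^sub>E {p. p permutes {0..<N}}.
        (\<Prod>k = 1..d. of_int (sign (\<sigma> k))) *
        (\<Prod>i = 0..<N. X (\<lambda>k \<in> {1..d}. b (\<sigma> k i))))"

definition shifted_imm_tensor ::
  "nat \<Rightarrow> 'a :: comm_ring_1 mat \<Rightarrow> (nat \<times> nat, 'a) hypermatrix" where
  "shifted_imm_tensor d X p =
     (\<Prod>k = 1..<d. if snd (p k) = fst (p (k + 1)) then 1 else 0) *
     X $$ (fst (p 1), snd (p d))"

definition imm_tensor ::
  "nat \<Rightarrow> nat \<Rightarrow> (nat \<times> nat, 'a :: comm_ring_1) hypermatrix" where
  "imm_tensor d n = shifted_imm_tensor d (1\<^sub>m n)"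

end

theory Submission
  imports Defs "HOL-Computational_Algebra.Polynomial"
begin

text \<open>
  Let \<open>A = [n]\<close> and let \<open>S\<close> be the matrix, indexed by functions \<open>A \<times> A \<rightarrow> A\<close>, whose entry \<open>S(f, g)\<close>
  is the sign of \<open>x \<mapsto> (f x, g x)\<close> if this is a permutation of \<open>A \<times> A\<close>, and \<open>0\<close> otherwise. The Kronecker
  deltas of the tensor turn the hyperdeterminant into \<open>tr (S^d) / (n^2)!\<close>. Both \<open>S\<close> and \<open>S^3\<close> are
  multiplied by \<open>sgn \<pi>\<close> when both indices are composed with a permutation \<open>\<pi>\<close> of \<open>A \<times> A\<close>, so both vanish
  where \<open>(f, g)\<close> is not injective, and hence \<open>S^3 = c S\<close> for a scalar \<open>c\<close>. Since \<open>tr (S^2) = \<plusminus> (n^2)!\<close>,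
  the hyperdeterminant is \<open>\<plusminus> c ^ (d/2 - 1)\<close>.

  Up to sign, \<open>c\<close> is the Fischer norm \<open>det(\<partial>)^n det^n\<close>, which Cayley's identity
  \<open>det(\<partial>) det^s = s (s + 1) \<cdots> (s + n - 1) det^(s - 1)\<close> evaluates. For the latter, distribute the row
  derivatives over the \<open>s\<close> factors by a map \<open>\<phi> : A \<rightarrow> [s]\<close>. The part belonging to \<open>\<phi>\<close> is
  \<open>det^(s - 1)\<close> times the number of permutations \<open>p\<close> with \<open>\<phi> \<circ> p = \<phi>\<close>, and these numbers add up
  to the rising factorial.
\<close>

subsection \<open>Signs of self-maps\<close>

text \<open>The Levi-Civita symbol. Only the values of \<open>u\<close> on \<open>A\<close> matter,
  and the value 0 on non-bijections lets signed sums run over all self-maps instead of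
  permutations.\<close>

definition levi :: "'a set \<Rightarrow> ('a \<Rightarrow> 'a) \<Rightarrow> int" where
  "levi A u = (if bij_betw u A A then sign_on A u else 0)"

lemma levi_cong: "(\<And>x. x \<in> A \<Longrightarrow> u x = v x) \<Longrightarrow> levi A u = levi A v"
  unfolding levi_def by (auto cong: bij_betw_cong sign_on_cong)

lemma levi_permutes: "p permutes A \<Longrightarrow> levi A p = sign p"
  by (simp add: levi_def permutes_imp_bij sign_on_permutes)

lemma levi_id [simp]: "levi A (\<lambda>x. x) = 1"
  by (simp add: levi_def bij_betw_def)

lemma levi_not_inj: "x \<in> A \<Longrightarrow> y \<in> A \<Longrightarrow> x \<noteq> y \<Longrightarrow> u x = u y \<Longrightarrow> levi A u = 0"
  by (auto simp: levi_def bij_betw_def inj_on_def)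

lemma levi_square: "levi A u * levi A u = (if bij_betw u A A then 1 else 0)"
  by (simp add: levi_def sign_on_def)

text \<open>Multiplicativity survives in the degenerate case: if the composite is bijective on the
  finite set \<open>A\<close>, then \<open>v\<close> is injective and \<open>u\<close> is
  surjective, so both are bijective.\<close>

lemma levi_compose:
  assumes "finite A" "u \<in> A \<rightarrow> A" "v \<in> A \<rightarrow> A"
  shows "levi A (\<lambda>x. u (v x)) = levi A u * levi A v"
proof (cases "bij_betw u A A \<and> bij_betw v A A")
  case True
  then have "bij_betw (\<lambda>x. u (v x)) A A"
    using bij_betw_trans[of v A A u A] by (simp add: comp_def)
  then show ?thesis
    using True assms(1) sign_on_compose[of u A v] by (simp add: levi_def comp_def)
next
  case False
  have "\<not> bij_betw (\<lambda>x. u (v x)) A A"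
  proof
    assume b: "bij_betw (\<lambda>x. u (v x)) A A"
    then have "inj_on v A"
      by (auto simp: bij_betw_def inj_on_def)
    then have v: "bij_betw v A A"
      using assms by (simp add: bij_betw_def endo_inj_surj image_subset_iff_funcset)
    have "A \<subseteq> u ` A"
    proof
      fix y assume "y \<in> A"
      then obtain x where "x \<in> A" "y = u (v x)"
        using b by (auto simp: bij_betw_def)
      then show "y \<in> u ` A"
        using assms(3) by auto
    qed
    then have "u ` A = A"
      using assms(2) by blast
    then have "bij_betw u A A"
      using assms(1) by (simp add: bij_betw_def eq_card_imp_inj_on)
    with v False show False by simp
  qed
  then show ?thesis
    using False by (auto simp: levi_def)
qed

text \<open>Relabelling along \<open>b\<close> carries the permutation induced by \<open>u\<close>
  to the one induced by \<open>v\<close>, and \<open>map_permutation\<close> preserves signs.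
  Conversely, a bijective \<open>v\<close> would make \<open>u\<close> injective, hence bijective on
  the finite set \<open>A\<close>.\<close>

lemma levi_conjugate:
  assumes "finite A" "bij_betw b A B" "u \<in> A \<rightarrow> A" "\<And>x. x \<in> A \<Longrightarrow> v (b x) = b (u x)"
  shows "levi B v = levi A u"
proof -
  have inj: "inj_on b A" and im: "b ` A = B"
    using assms(2) by (auto simp: bij_betw_def)
  have eq: "v y = b (u (inv_into A b y))" if "y \<in> B" for y
    using that im assms(4) inj by (auto simp: inv_into_f_f)
  show ?thesis
  proof (cases "bij_betw u A A")
    case True
    have "bij_betw (v \<circ> b) A B"
      using bij_betw_trans[OF True assms(2)] assms(4)
      by (subst bij_betw_cong[where g = "b \<circ> u"]) auto
    then have v: "bij_betw v B B"
      using bij_betw_comp_iff[OF assms(2)] by blast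
    have "map_permutation A b (restrict_id u A) = restrict_id v B"
      unfolding map_permutation_def im
      using im by (intro restrict_id_cong refl) (auto simp: eq inv_into_into)
    then have "sign_on B v = sign_on A u"
      using sign_map_permutation[OF inj permutes_restrict_id[OF True] assms(1)]
      by (simp add: sign_on_def)
    then show ?thesis
      using True v by (simp add: levi_def)
  next
    case False
    have "\<not> bij_betw v B B"
    proof
      assume "bij_betw v B B"
      then have "bij_betw (v \<circ> b) A B"
        using assms(2) by (rule bij_betw_trans[rotated])
      then have "inj_on (\<lambda>x. b (u x)) A"
        using assms(4) by (auto simp: bij_betw_def inj_on_def)
      then have "inj_on u A"
        by (auto simp: inj_on_def)
      then show False
        using False assms by (simp add: bij_betw_def endo_inj_surj image_subset_iff_funcset)
    qed
    then show ?thesis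
      using False by (simp add: levi_def)
  qed
qed

text \<open>Both signs are that of the same permutation \<open>restrict_id u B\<close>; if
  \<open>u\<close> is not bijective on the finite set \<open>B\<close>, it has a collision, which
  the extension inherits.\<close>

lemma levi_restrict_block:
  assumes "finite A" "B \<subseteq> A" "u \<in> B \<rightarrow> B"
  shows "levi A (\<lambda>x. if x \<in> B then u x else x) = levi B u"
proof (cases "bij_betw u B B")
  case True
  have "bij_betw (restrict_id u B) A A"
    using True assms(2) by (rule bij_betw_restrict_id)
  moreover have "restrict_id (restrict_id u B) A = restrict_id u B"
    using assms(2) by (auto simp: restrict_id_def fun_eq_iff)
  ultimately show ?thesis
    using True by (simp add: levi_def sign_on_def flip: restrict_id_def)
next
  case False
  have "finite B"
    using assms finite_subset by blast
  then have "\<not> inj_on u B"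
    using False assms(3) by (auto simp: bij_betw_def image_subset_iff_funcset dest: endo_inj_surj)
  then have "\<not> inj_on (\<lambda>x. if x \<in> B then u x else x) A"
    using assms(2) by (auto simp: inj_on_def)
  then show ?thesis
    using False by (auto simp: levi_def bij_betw_def)
qed

text \<open>As \<open>u\<close> preserves the fibres of \<open>\<phi>\<close>, it is a composite of
  maps that each act on one fibre and fix the rest, and \<open>levi\<close> is
  multiplicative.\<close>

lemma levi_blocks:
  assumes "finite A" "finite J" "u \<in> A \<rightarrow> A" "\<And>x. x \<in> A \<Longrightarrow> \<phi> (u x) = \<phi> x" "\<phi> ` A \<subseteq> J"
  shows "levi A u = (\<Prod>j\<in>J. levi A (\<lambda>x. if \<phi> x = j then u x else x))"
proof -
  \<comment> \<open>The induction is over the set \<open>K\<close> of fibres on which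
    \<open>u\<close> already acts.\<close>
  have "levi A (\<lambda>x. if \<phi> x \<in> K then u x else x) = (\<Prod>j\<in>K. levi A (\<lambda>x. if \<phi> x = j then u x else x))"
    if "finite K" for K
    using that
  proof (induction K)
    case (insert j K)
    have "levi A (\<lambda>x. if \<phi> x \<in> insert j K then u x else x) =
        levi A (\<lambda>x. (\<lambda>x. if \<phi> x = j then u x else x) (if \<phi> x \<in> K then u x else x))"
      using insert.hyps assms(4) by (intro levi_cong) auto
    also have "\<dots> = levi A (\<lambda>x. if \<phi> x = j then u x else x) * levi A (\<lambda>x. if \<phi> x \<in> K then u x else x)"
      using assms by (intro levi_compose) auto
    finally show ?case
      using insert by simp
  qed simp
  from this[OF assms(2)] show ?thesis
    using assms(5) by (subst levi_cong[where v = "\<lambda>x. if \<phi> x \<in> J then u x else x"]) auto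
qed

text \<open>The blocks here are the columns \<open>A \<times> {j}\<close>, each relabelled to
  \<open>A\<close>. This turns a pair sign whose second component is \<open>snd\<close> into a
  product of signs of self-maps of \<open>A\<close>.\<close>

lemma levi_columns:
  assumes "finite A" "finite J" "k \<in> A \<times> J \<rightarrow> A"
  shows "levi (A \<times> J) (\<lambda>x. (k x, snd x)) = (\<Prod>j\<in>J. levi A (\<lambda>a. k (a, j)))"
proof -
  have "levi (A \<times> J) (\<lambda>x. (k x, snd x)) =
      (\<Prod>j\<in>J. levi (A \<times> J) (\<lambda>x. if snd x = j then (k x, snd x) else x))"
    using assms by (intro levi_blocks) auto
  also have "\<dots> = (\<Prod>j\<in>J. levi A (\<lambda>a. k (a, j)))"
  proof (rule prod.cong[OF refl])
    fix j assume j: "j \<in> J"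
    have "levi (A \<times> J) (\<lambda>x. if snd x = j then (k x, snd x) else x) =
        levi (A \<times> J) (\<lambda>x. if x \<in> A \<times> {j} then (k x, snd x) else x)"
      by (intro levi_cong) auto
    also have "\<dots> = levi (A \<times> {j}) (\<lambda>x. (k x, snd x))"
      using assms j by (intro levi_restrict_block) auto
    also have "\<dots> = levi A (\<lambda>a. k (a, j))"
      using assms j by (intro levi_conjugate[where b = "\<lambda>a. (a, j)"]) (auto simp: bij_betw_def inj_on_def)
    finally show "levi (A \<times> J) (\<lambda>x. if snd x = j then (k x, snd x) else x) = levi A (\<lambda>a. k (a, j))" .
  qed
  finally show ?thesis .
qed

subsection \<open>Determinants over finite index sets\<close>

text \<open>Leibniz formula over an unordered index set. Summation over extensional functions,
  rather than permutations, makes products of determinants expandable by distributivity.\<close>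

definition ldet :: "'a set \<Rightarrow> ('a \<Rightarrow> 'a \<Rightarrow> 'r::comm_ring_1) \<Rightarrow> 'r" where
  "ldet A X = (\<Sum>u\<in>A \<rightarrow>\<^sub>E A. of_int (levi A u) * (\<Prod>a\<in>A. X a (u a)))"

text \<open>Translates between two conventions for a bijection of \<open>A\<close>: undefined
  outside \<open>A\<close> on the left, the identity outside \<open>A\<close> on the right.\<close>

lemma sum_bij_PiE_eq_sum_permutes:
  "(\<Sum>u | u \<in> A \<rightarrow>\<^sub>E A \<and> bij_betw u A A. F u) = (\<Sum>p | p permutes A. F (restrict p A))"
proof (rule sum.reindex_bij_witness[where j = "\<lambda>u. restrict_id u A" and i = "\<lambda>p. restrict p A"])
  fix u assume "u \<in> {u. u \<in> A \<rightarrow>\<^sub>E A \<and> bij_betw u A A}"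
  then have u: "u \<in> A \<rightarrow>\<^sub>E A" "bij_betw u A A" by auto
  show *: "restrict (restrict_id u A) A = u"
    by (rule ext) (simp add: restrict_def restrict_id_def PiE_arb[OF u(1)])
  show "restrict_id u A \<in> {p. p permutes A}"
    using u by (simp add: permutes_restrict_id)
  show "F (restrict (restrict_id u A) A) = F u"
    by (simp only: *)
next
  fix p assume "p \<in> {p. p permutes A}"
  then have p: "p permutes A" by simp
  show "restrict_id (restrict p A) A = p"
    by (rule ext) (simp add: restrict_def restrict_id_def permutes_not_in[OF p])
  have "bij_betw (restrict p A) A A"
    using permutes_imp_bij[OF p] by (subst bij_betw_cong[where g = p]) auto
  then show "restrict p A \<in> {u. u \<in> A \<rightarrow>\<^sub>E A \<and> bij_betw u A A}"
    using permutes_in_image[OF p] by auto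
qed

lemma ldet_permutes:
  assumes "finite A"
  shows "ldet A X = (\<Sum>p | p permutes A. of_int (sign p) * (\<Prod>a\<in>A. X a (p a)))"
proof -
  have "ldet A X = (\<Sum>u | u \<in> A \<rightarrow>\<^sub>E A \<and> bij_betw u A A. of_int (levi A u) * (\<Prod>a\<in>A. X a (u a)))"
    unfolding ldet_def using assms
    by (intro sum.mono_neutral_right) (auto simp: levi_def finite_PiE)
  also have "\<dots> = (\<Sum>p | p permutes A. of_int (sign p) * (\<Prod>a\<in>A. X a (p a)))"
    unfolding sum_bij_PiE_eq_sum_permutes
  proof (intro sum.cong refl arg_cong2[where f = "(*)"] prod.cong)
    fix p assume "p \<in> {p. p permutes A}"
    then show "(of_int (levi A (restrict p A)) :: 'b) = of_int (sign p)"
      by (simp add: levi_permutes levi_cong[of A "restrict p A" p])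
  qed simp
  finally show ?thesis .
qed

lemma ldet_transpose: "finite A \<Longrightarrow> ldet A (\<lambda>a b. X b a) = ldet A X"
proof -
  assume A: "finite A"
  have "(\<Sum>p | p permutes A. of_int (sign p) * (\<Prod>a\<in>A. X (p a) a)) =
      (\<Sum>p | p permutes A. of_int (sign (Hilbert_Choice.inv p)) * (\<Prod>a\<in>A. X (Hilbert_Choice.inv p a) a))"
    by (rule sum_permutations_inverse)
  also have "\<dots> = (\<Sum>p | p permutes A. of_int (sign p) * (\<Prod>a\<in>A. X a (p a)))"
  proof (rule sum.cong[OF refl])
    fix p assume "p \<in> {p. p permutes A}"
    then have p: "p permutes A" by simp
    have "(\<Prod>a\<in>A. X (Hilbert_Choice.inv p a) a) = (\<Prod>a\<in>A. X (Hilbert_Choice.inv p (p a)) (p a))"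
      using prod.permute[OF p, of "\<lambda>a. X (Hilbert_Choice.inv p a) a"] by (simp add: comp_def)
    then show "of_int (sign (Hilbert_Choice.inv p)) * (\<Prod>a\<in>A. X (Hilbert_Choice.inv p a) a) = of_int (sign p) * (\<Prod>a\<in>A. X a (p a))"
      using p A by (simp add: sign_inverse permutes_imp_permutation permutes_inverses)
  qed
  finally show ?thesis
    using A by (simp add: ldet_permutes)
qed

text \<open>A bijective selection is absorbed by reindexing the permutations. Otherwise two selected
  rows coincide, and the determinant vanishes because it is alternating.\<close>

lemma ldet_select_rows:
  fixes X :: "'a \<Rightarrow> 'a \<Rightarrow> 'r::{idom, ring_char_0}"
  assumes A: "finite A" and v: "v \<in> A \<rightarrow> A"
  shows "ldet A (\<lambda>a. X (v a)) = of_int (levi A v) * ldet A X"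
proof (cases "bij_betw v A A")
  case True
  define q where "q = restrict_id v A"
  have q: "q permutes A"
    using True by (simp add: q_def permutes_restrict_id)
  have "ldet A (\<lambda>a. X (v a)) = (\<Sum>p | p permutes A. of_int (sign p) * (\<Prod>a\<in>A. X (q a) (p a)))"
    by (simp add: ldet_permutes[OF A] q_def cong: prod.cong)
  also have "\<dots> = (\<Sum>p | p permutes A. of_int (sign (p \<circ> q)) * (\<Prod>a\<in>A. X (q a) ((p \<circ> q) a)))"
    by (rule sum_permutations_compose_right[OF q])
  also have "\<dots> = (\<Sum>p | p permutes A. of_int (sign q) * (of_int (sign p) * (\<Prod>a\<in>A. X a (p a))))"
  proof (rule sum.cong[OF refl])
    fix p assume "p \<in> {p. p permutes A}"
    then have "sign (p \<circ> q) = sign q * sign p"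
      using q A by (simp add: sign_compose permutes_imp_permutation mult.commute)
    then show "of_int (sign (p \<circ> q)) * (\<Prod>a\<in>A. X (q a) ((p \<circ> q) a)) =
        of_int (sign q) * (of_int (sign p) * (\<Prod>a\<in>A. X a (p a)))"
      using prod.permute[OF q, of "\<lambda>a. X a (p a)"] by (simp add: comp_def mult.assoc)
  qed
  also have "\<dots> = of_int (levi A v) * ldet A X"
    using True by (simp add: ldet_permutes[OF A] sum_distrib_left levi_def sign_on_def q_def)
  finally show ?thesis .
next
  case False
  then have "\<not> inj_on v A"
    using A v by (auto simp: bij_betw_def image_subset_iff_funcset dest: endo_inj_surj)
  then obtain x y where xy: "x \<in> A" "y \<in> A" "x \<noteq> y" "v x = v y"
    by (auto simp: inj_on_def)
  \<comment> \<open>Composing with \<open>t\<close> flips every sign but no product of entries, so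
    the sum equals its own negative; characteristic 0 then makes it vanish.\<close>
  define t where "t = Transposition.transpose x y"
  have t: "t permutes A" "sign t = -1" "\<And>a. t (t a) = a" "\<And>a. v (t a) = v a"
    using xy by (auto simp: t_def permutes_swap_id sign_swap_id Transposition.transpose_def)
  let ?f = "\<lambda>p. of_int (sign p) * (\<Prod>a\<in>A. X (v a) (p a))"
  have "ldet A (\<lambda>a. X (v a)) = (\<Sum>p | p permutes A. ?f (p \<circ> t))"
    by (subst ldet_permutes[OF A], rule sum_permutations_compose_right[OF t(1)])
  also have "\<dots> = (\<Sum>p | p permutes A. - ?f p)"
  proof (rule sum.cong[OF refl])
    fix p assume "p \<in> {p. p permutes A}"
    then have "sign (p \<circ> t) = - sign p"
      using t A by (simp add: sign_compose permutes_imp_permutation)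
    moreover have "(\<Prod>a\<in>A. X (v a) (p (t a))) = (\<Prod>a\<in>A. X (v a) (p a))"
      using prod.permute[OF t(1), of "\<lambda>a. X (v a) (p (t a))"] by (simp add: comp_def t)
    ultimately show "?f (p \<circ> t) = - ?f p" by simp
  qed
  also have "\<dots> = - ldet A (\<lambda>a. X (v a))"
    by (simp add: ldet_permutes[OF A] sum_negf)
  finally show ?thesis
    using False by (simp add: levi_def)
qed

lemma ldet_select_columns:
  fixes X :: "'a \<Rightarrow> 'a \<Rightarrow> 'r::{idom, ring_char_0}"
  assumes A: "finite A" and w: "w \<in> A \<rightarrow> A"
  shows "(\<Sum>u\<in>A \<rightarrow>\<^sub>E A. of_int (levi A u) * (\<Prod>a\<in>A. X (u a) (w a))) = of_int (levi A w) * ldet A X"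
  using ldet_select_rows[OF A w, of "\<lambda>a b. X b a"] ldet_transpose[OF A, of X]
  by (simp add: ldet_def[of A "\<lambda>a b. X b (w a)"])

text \<open>The sign of the term in a product of determinants indexed by \<open>J\<close> for which
  the factor \<open>j\<close> contributes the self-map \<open>a \<mapsto> k (a, j)\<close>.\<close>

definition colsign :: "'a set \<Rightarrow> 'j set \<Rightarrow> ('a \<times> 'j \<Rightarrow> 'a) \<Rightarrow> int" where
  "colsign A J k = (\<Prod>j\<in>J. levi A (\<lambda>a. k (a, j)))"

text \<open>Distributivity, with the family of self-maps chosen in the factors uncurried to a single
  function on \<open>A \<times> J\<close>.\<close>

lemma prod_ldet:
  assumes "finite A" "finite J"
  shows "(\<Prod>j\<in>J. ldet A (M j)) =
    (\<Sum>k\<in>A \<times> J \<rightarrow>\<^sub>E A. of_int (colsign A J k) * (\<Prod>a\<in>A. \<Prod>j\<in>J. M j a (k (a, j))))"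
proof -
  have "(\<Prod>j\<in>J. ldet A (M j)) =
      (\<Sum>g\<in>J \<rightarrow>\<^sub>E (A \<rightarrow>\<^sub>E A). \<Prod>j\<in>J. of_int (levi A (g j)) * (\<Prod>a\<in>A. M j a (g j a)))"
    unfolding ldet_def using assms by (intro prod_sum_PiE) (auto simp: finite_PiE)
  also have "\<dots> = (\<Sum>k\<in>A \<times> J \<rightarrow>\<^sub>E A. of_int (colsign A J k) * (\<Prod>a\<in>A. \<Prod>j\<in>J. M j a (k (a, j))))"
  proof (rule sum.reindex_bij_witness[where j = "\<lambda>g. \<lambda>(a, j)\<in>A \<times> J. g j a"
        and i = "\<lambda>k. \<lambda>j\<in>J. \<lambda>a\<in>A. k (a, j)"])
    fix g assume g: "g \<in> J \<rightarrow>\<^sub>E (A \<rightarrow>\<^sub>E A)"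
    show "(\<lambda>j\<in>J. \<lambda>a\<in>A. (\<lambda>(a, j)\<in>A \<times> J. g j a) (a, j)) = g"
    proof (intro ext)
      fix j a
      show "(\<lambda>j\<in>J. \<lambda>a\<in>A. (\<lambda>(a, j)\<in>A \<times> J. g j a) (a, j)) j a = g j a"
      proof (cases "j \<in> J")
        case True
        then have gj: "g j \<in> A \<rightarrow>\<^sub>E A" using g by auto
        show ?thesis
          using True by (cases "a \<in> A") (simp_all add: PiE_arb[OF gj])
      qed (simp add: PiE_arb[OF g])
    qed
    show "(\<lambda>(a, j)\<in>A \<times> J. g j a) \<in> A \<times> J \<rightarrow>\<^sub>E A"
    proof (rule restrict_PiE_iff[THEN iffD2], rule ballI)
      fix x assume "x \<in> A \<times> J"
      then show "(case x of (a, j) \<Rightarrow> g j a) \<in> A"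
        using PiE_mem[OF PiE_mem[OF g]] by auto
    qed
    have "levi A (\<lambda>a. (\<lambda>(a, j)\<in>A \<times> J. g j a) (a, j)) = levi A (g j)" if "j \<in> J" for j
      using that by (intro levi_cong) simp
    then have "colsign A J (\<lambda>(a, j)\<in>A \<times> J. g j a) = (\<Prod>j\<in>J. levi A (g j))"
      unfolding colsign_def by (intro prod.cong refl)
    moreover have "(\<Prod>a\<in>A. \<Prod>j\<in>J. M j a ((\<lambda>(a, j)\<in>A \<times> J. g j a) (a, j))) = (\<Prod>a\<in>A. \<Prod>j\<in>J. M j a (g j a))"
      by (intro prod.cong refl) simp
    ultimately show "of_int (colsign A J (\<lambda>(a, j)\<in>A \<times> J. g j a)) *
        (\<Prod>a\<in>A. \<Prod>j\<in>J. M j a ((\<lambda>(a, j)\<in>A \<times> J. g j a) (a, j))) =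
        (\<Prod>j\<in>J. of_int (levi A (g j)) * (\<Prod>a\<in>A. M j a (g j a)))"
      using prod.swap[of "\<lambda>a j. M j a (g j a)" J A] by (simp add: prod.distrib)
  next
    fix k assume k: "k \<in> A \<times> J \<rightarrow>\<^sub>E A"
    show "(\<lambda>(a, j)\<in>A \<times> J. (\<lambda>j\<in>J. \<lambda>a\<in>A. k (a, j)) j a) = k"
      by (rule ext) (auto simp: restrict_def PiE_arb[OF k])
    show "(\<lambda>j\<in>J. \<lambda>a\<in>A. k (a, j)) \<in> J \<rightarrow>\<^sub>E (A \<rightarrow>\<^sub>E A)"
      using PiE_mem[OF k] by (auto simp: restrict_PiE_iff)
  qed
  finally show ?thesis .
qed

subsection \<open>Cayley's identity\<close>

lemma sum_PiE_insert:
  assumes "a \<notin> A"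
  shows "(\<Sum>\<phi>\<in>insert a A \<rightarrow>\<^sub>E J. F \<phi>) = (\<Sum>y\<in>J. \<Sum>\<phi>\<in>A \<rightarrow>\<^sub>E J. F (\<phi>(a := y)))"
proof -
  have "(\<Sum>\<phi>\<in>insert a A \<rightarrow>\<^sub>E J. F \<phi>) = (\<Sum>(y, \<phi>)\<in>J \<times> (A \<rightarrow>\<^sub>E J). F (\<phi>(a := y)))"
    using inj_combinator[OF assms, of "\<lambda>_. J"]
    by (subst PiE_insert_eq, subst sum.reindex) (auto simp: comp_def case_prod_unfold)
  then show ?thesis
    by (simp add: sum.cartesian_product)
qed

text \<open>Double counting: for fixed \<open>p\<close> the sum counts the \<open>\<phi>\<close>
  that are constant on the cycles of \<open>p\<close>. Every permutation of
  \<open>insert a A\<close> is uniquely \<open>transpose a b \<circ> p\<close> with \<open>p\<close>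
  permuting \<open>A\<close>, and the cases \<open>b = a\<close> and \<open>b \<in> A\<close>
  together contribute the factor \<open>card J + card A\<close>.\<close>

lemma sum_stabilizers:
  assumes "finite A" "finite J"
  shows "(\<Sum>\<phi>\<in>A \<rightarrow>\<^sub>E J. card {p. p permutes A \<and> (\<forall>a\<in>A. \<phi> (p a) = \<phi> a)}) = (\<Prod>i<card A. card J + i)"
proof -
  have "(\<Sum>p | p permutes A. \<Sum>\<phi>\<in>A \<rightarrow>\<^sub>E J. of_bool (\<forall>a\<in>A. \<phi> (p a) = \<phi> a)) = (\<Prod>i<card A. card J + i)"
    using assms(1)
  proof (induction A)
    case (insert a A)
    let ?C = "\<Sum>p | p permutes A. \<Sum>\<phi>\<in>A \<rightarrow>\<^sub>E J. of_bool (\<forall>x\<in>A. \<phi> (p x) = \<phi> x) :: nat"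
    let ?F = "\<lambda>p. \<Sum>\<phi>\<in>insert a A \<rightarrow>\<^sub>E J. of_bool (\<forall>x\<in>insert a A. \<phi> (p x) = \<phi> x) :: nat"
    have notin: "p x \<noteq> a" if "p permutes A" "x \<in> A" for p x
      using that insert.hyps(2) permutes_in_image by fastforce
    have fixed: "p a = a" if "p permutes A" for p
      using that insert.hyps(2) by (rule permutes_not_in)
    \<comment> \<open>Here \<open>a\<close> is a new fixed point, so its value under
      \<open>\<phi>\<close> is free.\<close>
    have same: "?F p = card J * (\<Sum>\<phi>\<in>A \<rightarrow>\<^sub>E J. of_bool (\<forall>x\<in>A. \<phi> (p x) = \<phi> x))" if p: "p permutes A" for p
    proof -
      have "?F p = (\<Sum>y\<in>J. \<Sum>\<phi>\<in>A \<rightarrow>\<^sub>E J. of_bool (\<forall>x\<in>A. \<phi> (p x) = \<phi> x))"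
        unfolding sum_PiE_insert[OF insert.hyps(2)]
        using p insert.hyps(2) by (intro sum.cong refl arg_cong[where f = of_bool]) (auto simp: fixed notin)
      then show ?thesis by simp
    qed
    \<comment> \<open>Here \<open>a\<close> is inserted into the cycle just before \<open>b\<close>,
      which forces its value to be \<open>\<phi> b\<close>.\<close>
    have swap: "?F (Transposition.transpose a b \<circ> p) = (\<Sum>\<phi>\<in>A \<rightarrow>\<^sub>E J. of_bool (\<forall>x\<in>A. \<phi> (p x) = \<phi> x))"
      if p: "p permutes A" and b: "b \<in> A" for b p
    proof -
      have iff: "(\<forall>x\<in>insert a A. (\<phi>(a := y)) ((Transposition.transpose a b \<circ> p) x) = (\<phi>(a := y)) x) \<longleftrightarrow>
          y = \<phi> b \<and> (\<forall>x\<in>A. \<phi> (p x) = \<phi> x)" for \<phi> :: "'a \<Rightarrow> 'b" and y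
      proof -
        have ne: "b \<noteq> a" using b insert.hyps(2) by auto
        have *: "(\<phi>(a := y)) (Transposition.transpose a b (p x)) = (if p x = b then y else \<phi> (p x))"
          if "x \<in> A" for x
          using notin[OF p that] ne by (auto simp: Transposition.transpose_def)
        have "(\<forall>x\<in>insert a A. (\<phi>(a := y)) ((Transposition.transpose a b \<circ> p) x) = (\<phi>(a := y)) x) \<longleftrightarrow>
          \<phi> b = y \<and> (\<forall>x\<in>A. (if p x = b then y else \<phi> (p x)) = \<phi> x)"
        proof -
          have "(\<phi>(a := y)) x = \<phi> x" if "x \<in> A" for x
            using that insert.hyps(2) by auto
          moreover have "(\<phi>(a := y)) (Transposition.transpose a b (p a)) = \<phi> b" "(\<phi>(a := y)) a = y"
            using ne by (simp_all add: fixed[OF p])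
          ultimately show ?thesis
            by (simp add: * del: fun_upd_apply)
        qed
        then show ?thesis by auto
      qed
      have "?F (Transposition.transpose a b \<circ> p) =
          (\<Sum>\<phi>\<in>A \<rightarrow>\<^sub>E J. \<Sum>y\<in>J. of_bool (y = \<phi> b \<and> (\<forall>x\<in>A. \<phi> (p x) = \<phi> x)))"
        unfolding sum_PiE_insert[OF insert.hyps(2)] iff by (rule sum.swap)
      also have "\<dots> = (\<Sum>\<phi>\<in>A \<rightarrow>\<^sub>E J. of_bool (\<forall>x\<in>A. \<phi> (p x) = \<phi> x))"
      proof (rule sum.cong[OF refl])
        fix \<phi> assume "\<phi> \<in> A \<rightarrow>\<^sub>E J"
        then have "\<phi> b \<in> J" using b by auto
        then show "(\<Sum>y\<in>J. of_bool (y = \<phi> b \<and> (\<forall>x\<in>A. \<phi> (p x) = \<phi> x))) = (of_bool (\<forall>x\<in>A. \<phi> (p x) = \<phi> x) :: nat)"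
          using assms(2) by (simp add: of_bool_conj sum.remove[of J "\<phi> b"])
      qed
      finally show ?thesis .
    qed
    have "(\<Sum>p | p permutes insert a A. ?F p) =
        (\<Sum>b\<in>insert a A. \<Sum>p | p permutes A. ?F (Transposition.transpose a b \<circ> p))"
      by (rule sum_over_permutations_insert) fact+
    also have "\<dots> = (\<Sum>p | p permutes A. ?F p) + (\<Sum>b\<in>A. \<Sum>p | p permutes A. ?F (Transposition.transpose a b \<circ> p))"
      using insert.hyps by simp
    also have "(\<Sum>p | p permutes A. ?F p) = card J * ?C"
      by (subst sum_distrib_left, rule sum.cong) (simp_all only: same mem_Collect_eq)
    also have "(\<Sum>b\<in>A. \<Sum>p | p permutes A. ?F (Transposition.transpose a b \<circ> p)) = card A * ?C"
    proof -
      have "(\<Sum>p | p permutes A. ?F (Transposition.transpose a b \<circ> p)) = ?C" if "b \<in> A" for b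
        by (rule sum.cong) (simp_all only: swap mem_Collect_eq that)
      then show ?thesis by simp
    qed
    finally show ?case
      using insert by (simp add: algebra_simps)
  qed simp
  moreover have "card {p. p permutes A \<and> (\<forall>a\<in>A. \<phi> (p a) = \<phi> a)} =
      (\<Sum>p | p permutes A. of_bool (\<forall>a\<in>A. \<phi> (p a) = \<phi> a))" for \<phi> :: "'a \<Rightarrow> 'b"
    using finite_permutations[OF assms(1)]
    by (simp add: of_bool_def sum.If_cases Collect_conj_eq)
  ultimately show ?thesis
    by (simp add: sum.swap[of _ "A \<rightarrow>\<^sub>E J"])
qed

text \<open>The part of \<open>det(\<partial>) det^J\<close> in which the derivative in row \<open>a\<close> hits the factor with index \<open>\<phi> a\<close>.\<close>

definition omega_part :: "'a set \<Rightarrow> 'j set \<Rightarrow> ('a \<Rightarrow> 'j) \<Rightarrow> ('a \<Rightarrow> 'a \<Rightarrow> 'r::comm_ring_1) \<Rightarrow> 'r" where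
  "omega_part A J \<phi> X = (\<Sum>k\<in>A \<times> J \<rightarrow>\<^sub>E A. of_int (colsign A J k * levi A (\<lambda>a. k (a, \<phi> a))) *
     (\<Prod>a\<in>A. \<Prod>j\<in>J - {\<phi> a}. X a (k (a, j))))"

text \<open>If \<open>p\<close> preserves the fibres of \<open>\<phi>\<close>, the product of the
  block signs is \<open>sign p\<close> again, and the square is 1. Otherwise some block map has a
  collision.\<close>

lemma sign_times_blocks:
  assumes "finite A" and J: "finite J" and "\<phi> \<in> A \<rightarrow> J" and p: "p permutes A"
  shows "sign p * (\<Prod>j\<in>J. levi A (\<lambda>a. if \<phi> a = j then p a else a)) = of_bool (\<forall>a\<in>A. \<phi> (p a) = \<phi> a)"
proof (cases "\<forall>a\<in>A. \<phi> (p a) = \<phi> a")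
  case True
  have "sign p = (\<Prod>j\<in>J. levi A (\<lambda>a. if \<phi> a = j then p a else a))"
    using assms True permutes_in_image[OF p]
    by (subst levi_permutes[OF p, symmetric], intro levi_blocks) auto
  then show ?thesis
    using True by (simp flip: \<open>sign p = _\<close>)
next
  case False
  then obtain a where a: "a \<in> A" "\<phi> (p a) \<noteq> \<phi> a" by auto
  \<comment> \<open>This map sends \<open>a\<close> to \<open>p a\<close> and fixes
    \<open>p a\<close>, which lies in a different fibre.\<close>
  then have "levi A (\<lambda>x. if \<phi> x = \<phi> a then p x else x) = 0"
    using permutes_in_image[OF p] by (intro levi_not_inj[of a _ "p a"]) auto
  then show ?thesis
    using assms a by (subst prod_zero[OF J]) auto
qed

text \<open>
  Summing over \<open>p\<close>, with signs, the products over \<open>j \<in> J\<close> of the determinants of \<open>X\<close> with each row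
  \<open>a \<in> \<phi>^(-1)(j)\<close> replaced by row \<open>p a\<close>: every such determinant is \<open>det X\<close> up to sign or \<open>0\<close>, whereas
  summing over \<open>p\<close> first splits off one factor \<open>det X\<close>.
\<close>

lemma ldet_times_omega_part:
  fixes X :: "'a \<Rightarrow> 'a \<Rightarrow> 'r::{idom, ring_char_0}"
  assumes A: "finite A" and J: "finite J" and \<phi>: "\<phi> \<in> A \<rightarrow> J"
  shows "ldet A X * omega_part A J \<phi> X =
    ldet A X ^ card J * of_nat (card {p. p permutes A \<and> (\<forall>a\<in>A. \<phi> (p a) = \<phi> a)})"
proof -
  define M where "M p j a = (if \<phi> a = j then X (p a) else X a)" for p j a
  define G where "G = (\<Sum>p | p permutes A. of_int (sign p) * (\<Prod>j\<in>J. ldet A (M p j)))"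
  have "of_int (sign p) * (\<Prod>j\<in>J. ldet A (M p j)) =
      ldet A X ^ card J * of_bool (\<forall>a\<in>A. \<phi> (p a) = \<phi> a)" if p: "p permutes A" for p
  proof -
    have "ldet A (M p j) = of_int (levi A (\<lambda>a. if \<phi> a = j then p a else a)) * ldet A X" for j
    proof -
      have "M p j = (\<lambda>a. X (if \<phi> a = j then p a else a))"
        by (auto simp: M_def)
      then show ?thesis
        using permutes_in_image[OF p] by (simp only:) (intro ldet_select_rows[OF A], auto)
    qed
    then have "of_int (sign p) * (\<Prod>j\<in>J. ldet A (M p j)) =
       of_int (sign p * (\<Prod>j\<in>J. levi A (\<lambda>a. if \<phi> a = j then p a else a))) * ldet A X ^ card J"
      by (simp add: prod.distrib mult.assoc)
    then show ?thesis
      by (simp only: sign_times_blocks[OF A J \<phi> p]) simp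
  qed
  then have "G = ldet A X ^ card J * (\<Sum>p | p permutes A. of_bool (\<forall>a\<in>A. \<phi> (p a) = \<phi> a))"
    by (simp add: G_def sum_distrib_left)
  also have "(\<Sum>p | p permutes A. of_bool (\<forall>a\<in>A. \<phi> (p a) = \<phi> a)) =
      of_nat (card {p. p permutes A \<and> (\<forall>a\<in>A. \<phi> (p a) = \<phi> a)})"
    using finite_permutations[OF A]
    by (simp add: of_bool_def sum.If_cases Collect_conj_eq)
  finally have G1: "G = ldet A X ^ card J * of_nat (card {p. p permutes A \<and> (\<forall>a\<in>A. \<phi> (p a) = \<phi> a)})" .
  \<comment> \<open>In row \<open>a\<close> only the factor \<open>j = \<phi> a\<close> is modified,
    so \<open>p\<close> enters through a single entry per row.\<close>
  have "(\<Prod>a\<in>A. \<Prod>j\<in>J. M p j a (k (a, j))) =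
      (\<Prod>a\<in>A. X (p a) (k (a, \<phi> a))) * (\<Prod>a\<in>A. \<Prod>j\<in>J - {\<phi> a}. X a (k (a, j)))" for p k
    unfolding prod.distrib[symmetric]
  proof (rule prod.cong[OF refl])
    fix a assume "a \<in> A"
    then have "\<phi> a \<in> J" using \<phi> by auto
    then show "(\<Prod>j\<in>J. M p j a (k (a, j))) = X (p a) (k (a, \<phi> a)) * (\<Prod>j\<in>J - {\<phi> a}. X a (k (a, j)))"
      unfolding prod.remove[OF J \<open>\<phi> a \<in> J\<close>]
      by (intro arg_cong2[where f = "(*)"] prod.cong refl) (auto simp: M_def)
  qed
  then have "G = (\<Sum>p | p permutes A. \<Sum>k\<in>A \<times> J \<rightarrow>\<^sub>E A.
      of_int (colsign A J k) * (\<Prod>a\<in>A. \<Prod>j\<in>J - {\<phi> a}. X a (k (a, j))) *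
      (of_int (sign p) * (\<Prod>a\<in>A. X (p a) (k (a, \<phi> a)))))"
    unfolding G_def prod_ldet[OF A J] sum_distrib_left
    by (intro sum.cong refl) (simp only: mult_ac)
  also have "\<dots> = (\<Sum>k\<in>A \<times> J \<rightarrow>\<^sub>E A.
      of_int (colsign A J k) * (\<Prod>a\<in>A. \<Prod>j\<in>J - {\<phi> a}. X a (k (a, j))) *
      (\<Sum>p | p permutes A. of_int (sign p) * (\<Prod>a\<in>A. X (p a) (k (a, \<phi> a)))))"
    by (subst sum.swap) (simp only: sum_distrib_left)
  \<comment> \<open>For fixed \<open>k\<close> the inner sum is the determinant of \<open>X\<close>
    with the columns \<open>k (a, \<phi> a)\<close> selected; this is the factor that splits
    off.\<close>
  also have "\<dots> = (\<Sum>k\<in>A \<times> J \<rightarrow>\<^sub>E A.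
      of_int (colsign A J k) * (\<Prod>a\<in>A. \<Prod>j\<in>J - {\<phi> a}. X a (k (a, j))) *
      (of_int (levi A (\<lambda>a. k (a, \<phi> a))) * ldet A X))"
  proof (intro sum.cong refl arg_cong2[where f = "(*)"])
    fix k assume "k \<in> A \<times> J \<rightarrow>\<^sub>E A"
    then have "(\<lambda>a. k (a, \<phi> a)) \<in> A \<rightarrow> A"
      using \<phi> by auto
    from ldet_select_columns[OF A this, of X]
    show "(\<Sum>p | p permutes A. of_int (sign p) * (\<Prod>a\<in>A. X (p a) (k (a, \<phi> a)))) =
        of_int (levi A (\<lambda>a. k (a, \<phi> a))) * ldet A X"
      using ldet_permutes[OF A, of "\<lambda>a b. X b (k (a, \<phi> a))"]
      by (simp add: ldet_def)
  qed
  also have "\<dots> = ldet A X * omega_part A J \<phi> X"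
    unfolding omega_part_def sum_distrib_left
    by (intro sum.cong refl) (simp only: of_int_mult mult_ac)
  finally show ?thesis
    using G1 by simp
qed

lemma ldet_one: "finite A \<Longrightarrow> ldet A (\<lambda>a b. if a = b then 1 else 0) = (1 :: 'r::comm_ring_1)"
proof -
  assume A: "finite A"
  have "(\<Prod>a\<in>A. if a = p a then 1 else 0 :: 'r) = of_bool (p = id)" if p: "p permutes A" for p
  proof (cases "p = id")
    case False
    then obtain a where "p a \<noteq> a" by (auto simp: fun_eq_iff)
    then have "a \<in> A" "(if a = p a then 1 else 0 :: 'r) = 0"
      using permutes_not_in[OF p] by auto
    with False show ?thesis
      using A by (subst prod_zero[of A]) auto
  qed simp
  then have "ldet A (\<lambda>a b. if a = b then 1 else 0) = (\<Sum>p | p permutes A. of_int (sign p) * of_bool (p = id) :: 'r)"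
    using A by (simp add: ldet_permutes)
  also have "\<dots> = 1"
    using finite_permutations[OF A] by (subst sum.remove[of _ id]) (auto simp: permutes_id)
  finally show ?thesis .
qed

lemma poly_ldet: "poly (ldet A T) x = ldet A (\<lambda>a b. poly (T a b) x)"
  by (simp add: ldet_def poly_sum poly_prod)

lemma poly_omega_part: "poly (omega_part A J \<phi> T) x = omega_part A J \<phi> (\<lambda>a b. poly (T a b) x)"
  by (simp add: omega_part_def poly_sum poly_prod)

text \<open>
  To cancel \<open>det X\<close> also where it vanishes, work over polynomials on the line from \<open>X\<close> to the
  identity matrix.
\<close>

lemma omega_part_eq:
  fixes X :: "'a \<Rightarrow> 'a \<Rightarrow> 'r::{idom, ring_char_0}"
  assumes A: "finite A" and J: "finite J" "card J = Suc m" and \<phi>: "\<phi> \<in> A \<rightarrow> J"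
  shows "omega_part A J \<phi> X =
    ldet A X ^ m * of_nat (card {p. p permutes A \<and> (\<forall>a\<in>A. \<phi> (p a) = \<phi> a)})"
proof -
  define T where "T a b = [:X a b, (if a = b then 1 else 0) - X a b:]" for a b
  have T0: "(\<lambda>a b. poly (T a b) 0) = X" and T1: "(\<lambda>a b. poly (T a b) 1) = (\<lambda>a b. if a = b then 1 else 0)"
    by (auto simp: T_def fun_eq_iff)
  have "poly (ldet A T) 1 = 1"
    by (simp add: poly_ldet T1 ldet_one[OF A])
  then have nz: "ldet A T \<noteq> 0" by auto
  have "ldet A T * omega_part A J \<phi> T =
      ldet A T * (ldet A T ^ m * of_nat (card {p. p permutes A \<and> (\<forall>a\<in>A. \<phi> (p a) = \<phi> a)}))"
    using ldet_times_omega_part[OF A J(1) \<phi>, of T] J(2) by simp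
  then have "omega_part A J \<phi> T = ldet A T ^ m * of_nat (card {p. p permutes A \<and> (\<forall>a\<in>A. \<phi> (p a) = \<phi> a)})"
    using nz mult_left_cancel by blast
  then have "poly (omega_part A J \<phi> T) 0 =
      poly (ldet A T ^ m * of_nat (card {p. p permutes A \<and> (\<forall>a\<in>A. \<phi> (p a) = \<phi> a)})) 0"
    by (rule arg_cong)
  then show ?thesis
    by (simp add: poly_omega_part poly_ldet T0)
qed

subsection \<open>Polarization\<close>

text \<open>Inclusion-exclusion: with \<open>C = P - B\<close> the sum is the expansion of a product
  of factors \<open>1 - 1\<close> over \<open>P - R\<close>, which is empty exactly for
  \<open>R = P\<close>.\<close>

lemma sum_Pow_alternating:
  assumes "finite P" "R \<subseteq> P"
  shows "(\<Sum>B | R \<subseteq> B \<and> B \<subseteq> P. (-1) ^ card (P - B)) = (of_bool (R = P) :: 'r::comm_ring_1)"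
proof -
  have "(\<Sum>B | R \<subseteq> B \<and> B \<subseteq> P. (-1) ^ card (P - B)) = (\<Sum>C\<in>Pow (P - R). (-1) ^ card C :: 'r)"
    using assms(2)
    by (intro sum.reindex_bij_witness[where i = "\<lambda>C. P - C" and j = "\<lambda>B. P - B"])
      (auto simp: double_diff)
  also have "\<dots> = (\<Prod>x\<in>P - R. 1 - 1)"
    using assms(1) by (subst prod_diff_conv_sum) auto
  also have "\<dots> = of_bool (R = P)"
    using assms by (auto simp: power_0_left card_0_eq)
  finally show ?thesis .
qed

text \<open>Ryser's formula for the permanent. Expanding gives all maps \<open>g\<close> with image
  inside \<open>B\<close>; the alternating sum over \<open>B\<close> keeps only those with image
  \<open>P\<close>, which are the permutations.\<close>

lemma ryser:
  fixes M :: "'p \<Rightarrow> 'p \<Rightarrow> 'r::comm_ring_1"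
  assumes P: "finite P"
  shows "(\<Sum>B\<in>Pow P. (-1) ^ card (P - B) * (\<Prod>p\<in>P. \<Sum>x\<in>B. M p x)) = (\<Sum>\<theta> | \<theta> permutes P. \<Prod>p\<in>P. M p (\<theta> p))"
proof -
  have "(\<Prod>p\<in>P. \<Sum>x\<in>B. M p x) = (\<Sum>g\<in>P \<rightarrow>\<^sub>E P. of_bool (g ` P \<subseteq> B) * (\<Prod>p\<in>P. M p (g p)))" if "B \<subseteq> P" for B
  proof -
    have "(\<Prod>p\<in>P. \<Sum>x\<in>B. M p x) = (\<Sum>g\<in>P \<rightarrow>\<^sub>E B. \<Prod>p\<in>P. M p (g p))"
      using P that finite_subset by (intro prod_sum_PiE) auto
    also have "\<dots> = (\<Sum>g\<in>P \<rightarrow>\<^sub>E P. of_bool (g ` P \<subseteq> B) * (\<Prod>p\<in>P. M p (g p)))"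
      using P that by (intro sum.mono_neutral_cong_left) (auto simp: finite_PiE PiE_iff image_subset_iff)
    finally show ?thesis .
  qed
  then have "(\<Sum>B\<in>Pow P. (-1) ^ card (P - B) * (\<Prod>p\<in>P. \<Sum>x\<in>B. M p x)) =
      (\<Sum>B\<in>Pow P. \<Sum>g\<in>P \<rightarrow>\<^sub>E P. (\<Prod>p\<in>P. M p (g p)) * (of_bool (g ` P \<subseteq> B) * (-1) ^ card (P - B)))"
    by (intro sum.cong refl) (simp add: sum_distrib_left mult_ac)
  also have "\<dots> = (\<Sum>g\<in>P \<rightarrow>\<^sub>E P. (\<Prod>p\<in>P. M p (g p)) * (\<Sum>B\<in>Pow P. of_bool (g ` P \<subseteq> B) * (-1) ^ card (P - B)))"
    by (subst sum.swap) (simp only: sum_distrib_left)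
  also have "\<dots> = (\<Sum>g\<in>P \<rightarrow>\<^sub>E P. (\<Prod>p\<in>P. M p (g p)) * of_bool (g ` P = P))"
  proof (intro sum.cong refl arg_cong2[where f = "(*)"])
    fix g assume "g \<in> P \<rightarrow>\<^sub>E P"
    then have g: "g ` P \<subseteq> P" by auto
    have "(\<Sum>B\<in>Pow P. of_bool (g ` P \<subseteq> B) * (-1) ^ card (P - B)) =
        (\<Sum>B | g ` P \<subseteq> B \<and> B \<subseteq> P. (-1) ^ card (P - B) :: 'r)"
      using P by (intro sum.mono_neutral_cong_right) auto
    then show "(\<Sum>B\<in>Pow P. of_bool (g ` P \<subseteq> B) * (-1) ^ card (P - B)) = (of_bool (g ` P = P) :: 'r)"
      by (simp only: sum_Pow_alternating[OF P g])
  qed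
  also have "\<dots> = (\<Sum>g | g \<in> P \<rightarrow>\<^sub>E P \<and> bij_betw g P P. \<Prod>p\<in>P. M p (g p))"
    using P by (intro sum.mono_neutral_cong_right)
      (auto simp: finite_PiE bij_betw_def eq_card_imp_inj_on)
  finally show ?thesis
    unfolding sum_bij_PiE_eq_sum_permutes by simp
qed

lemma prod_of_bool:
  "finite P \<Longrightarrow> (\<Prod>p\<in>P. of_bool (Q p)) = (of_bool (\<forall>p\<in>P. Q p) :: 'r::comm_semiring_1)"
  by (induction P rule: finite_induct) auto

text \<open>The matrix \<open>t B\<close> counts the positions in \<open>B\<close> with given row
  and letter. After the alternating sum over \<open>B\<close>, Ryser's formula turns each monomial
  into a permanent of indicators, in which only row-preserving \<open>\<theta>\<close> with
  \<open>w = k \<circ> \<theta>\<close> on \<open>P\<close> survive.\<close>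

lemma polarization_aux:
  fixes L :: "('p \<Rightarrow> 'a) \<Rightarrow> int" and \<rho> :: "'p \<Rightarrow> 'b"
  assumes P: "finite P" and A: "finite A" and k: "k \<in> P \<rightarrow> A"
  defines "t \<equiv> \<lambda>B r c. \<Sum>x\<in>B. of_bool (\<rho> x = r \<and> k x = c)"
  shows "(\<Sum>B\<in>Pow P. (-1) ^ card (P - B) * (\<Sum>w\<in>P \<rightarrow>\<^sub>E A. L w * (\<Prod>p\<in>P. t B (\<rho> p) (w p)))) =
    (\<Sum>\<theta> | \<theta> permutes P \<and> (\<forall>p\<in>P. \<rho> (\<theta> p) = \<rho> p). L (\<lambda>p\<in>P. k (\<theta> p)))"
proof -
  have "(\<Sum>B\<in>Pow P. (-1) ^ card (P - B) * (\<Sum>w\<in>P \<rightarrow>\<^sub>E A. L w * (\<Prod>p\<in>P. t B (\<rho> p) (w p)))) =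
      (\<Sum>w\<in>P \<rightarrow>\<^sub>E A. L w * (\<Sum>B\<in>Pow P. (-1) ^ card (P - B) * (\<Prod>p\<in>P. t B (\<rho> p) (w p))))"
    unfolding sum_distrib_left by (subst sum.swap) (simp only: mult_ac)
  also have "\<dots> = (\<Sum>w\<in>P \<rightarrow>\<^sub>E A. L w * (\<Sum>\<theta> | \<theta> permutes P. \<Prod>p\<in>P. of_bool (\<rho> (\<theta> p) = \<rho> p \<and> k (\<theta> p) = w p)))"
    unfolding t_def by (simp only: ryser[OF P])
  also have "\<dots> = (\<Sum>\<theta> | \<theta> permutes P. \<Sum>w\<in>P \<rightarrow>\<^sub>E A. L w * of_bool (\<forall>p\<in>P. \<rho> (\<theta> p) = \<rho> p \<and> k (\<theta> p) = w p))"
    unfolding sum_distrib_left using P by (subst sum.swap) (simp only: prod_of_bool)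
  also have "\<dots> = (\<Sum>\<theta> | \<theta> permutes P. of_bool (\<forall>p\<in>P. \<rho> (\<theta> p) = \<rho> p) * L (\<lambda>p\<in>P. k (\<theta> p)))"
  proof (rule sum.cong[OF refl])
    fix \<theta> assume "\<theta> \<in> {\<theta>. \<theta> permutes P}"
    then have \<theta>: "\<theta> permutes P" by simp
    define w0 where "w0 = (\<lambda>p\<in>P. k (\<theta> p))"
    have w0: "w0 \<in> P \<rightarrow>\<^sub>E A"
      using k permutes_in_image[OF \<theta>] by (auto simp: w0_def)
    have "(\<Sum>w\<in>P \<rightarrow>\<^sub>E A. L w * of_bool (\<forall>p\<in>P. \<rho> (\<theta> p) = \<rho> p \<and> k (\<theta> p) = w p)) =
        (\<Sum>w\<in>P \<rightarrow>\<^sub>E A. if w = w0 then of_bool (\<forall>p\<in>P. \<rho> (\<theta> p) = \<rho> p) * L w0 else 0)"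
    proof (rule sum.cong[OF refl])
      fix w assume w: "w \<in> P \<rightarrow>\<^sub>E A"
      have "(\<forall>p\<in>P. k (\<theta> p) = w p) \<longleftrightarrow> w = w0"
        using PiE_ext[OF w w0] by (auto simp: w0_def)
      then show "L w * of_bool (\<forall>p\<in>P. \<rho> (\<theta> p) = \<rho> p \<and> k (\<theta> p) = w p) =
          (if w = w0 then of_bool (\<forall>p\<in>P. \<rho> (\<theta> p) = \<rho> p) * L w0 else 0)"
        by (auto simp: ball_conj_distrib)
    qed
    also have "\<dots> = of_bool (\<forall>p\<in>P. \<rho> (\<theta> p) = \<rho> p) * L w0"
      using w0 P A by (simp add: sum.delta finite_PiE)
    finally show "(\<Sum>w\<in>P \<rightarrow>\<^sub>E A. L w * of_bool (\<forall>p\<in>P. \<rho> (\<theta> p) = \<rho> p \<and> k (\<theta> p) = w p)) =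
        of_bool (\<forall>p\<in>P. \<rho> (\<theta> p) = \<rho> p) * L (\<lambda>p\<in>P. k (\<theta> p))"
      by (simp add: w0_def)
  qed
  also have "\<dots> = (\<Sum>\<theta> | \<theta> permutes P \<and> (\<forall>p\<in>P. \<rho> (\<theta> p) = \<rho> p). L (\<lambda>p\<in>P. k (\<theta> p)))"
    using finite_permutations[OF P] by (intro sum.mono_neutral_cong_right) auto
  finally show ?thesis .
qed

text \<open>
  Equality of two polynomials, with coefficients collected by words \<open>w\<close>, implies equality of the
  symmetrized coefficients; Ryser's formula expresses the latter through values.
\<close>

lemma polarization:
  fixes L L' :: "('p \<Rightarrow> 'a) \<Rightarrow> int"
  assumes "finite P" "finite A" "k \<in> P \<rightarrow> A"
    and "\<And>t :: 'b \<Rightarrow> 'a \<Rightarrow> int. (\<Sum>w\<in>P \<rightarrow>\<^sub>E A. L w * (\<Prod>p\<in>P. t (\<rho> p) (w p))) =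
      (\<Sum>w\<in>P \<rightarrow>\<^sub>E A. L' w * (\<Prod>p\<in>P. t (\<rho> p) (w p)))"
  shows "(\<Sum>\<theta> | \<theta> permutes P \<and> (\<forall>p\<in>P. \<rho> (\<theta> p) = \<rho> p). L (\<lambda>p\<in>P. k (\<theta> p))) =
    (\<Sum>\<theta> | \<theta> permutes P \<and> (\<forall>p\<in>P. \<rho> (\<theta> p) = \<rho> p). L' (\<lambda>p\<in>P. k (\<theta> p)))"
  unfolding polarization_aux[OF assms(1-3), symmetric]
proof (rule sum.cong[OF refl])
  fix B
  show "(-1) ^ card (P - B) * (\<Sum>w\<in>P \<rightarrow>\<^sub>E A. L w * (\<Prod>p\<in>P. \<Sum>x\<in>B. of_bool (\<rho> x = \<rho> p \<and> k x = w p))) =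
      (-1) ^ card (P - B) * (\<Sum>w\<in>P \<rightarrow>\<^sub>E A. L' w * (\<Prod>p\<in>P. \<Sum>x\<in>B. of_bool (\<rho> x = \<rho> p \<and> k x = w p)))"
    using assms(4)[of "\<lambda>r c. \<Sum>x\<in>B. of_bool (\<rho> x = r \<and> k x = c)"] by (simp only:)
qed

lemma sum_PiE_permute:
  assumes p: "\<sigma> permutes S"
  shows "(\<Sum>k\<in>S \<rightarrow>\<^sub>E B. F (\<lambda>x\<in>S. k (\<sigma> x))) = (\<Sum>k\<in>S \<rightarrow>\<^sub>E B. F k)"
proof (rule sum.reindex_bij_witness[where j = "\<lambda>k. \<lambda>x\<in>S. k (\<sigma> x)" and i = "\<lambda>k. \<lambda>x\<in>S. k (Hilbert_Choice.inv \<sigma> x)"])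
  fix k assume k: "k \<in> S \<rightarrow>\<^sub>E B"
  show "(\<lambda>x\<in>S. (\<lambda>x\<in>S. k (\<sigma> x)) (Hilbert_Choice.inv \<sigma> x)) = k"
    using permutes_in_image[OF permutes_inv[OF p]]
    by (intro ext) (simp add: restrict_def permutes_inverses[OF p] PiE_arb[OF k])
  show "(\<lambda>x\<in>S. (\<lambda>x\<in>S. k (Hilbert_Choice.inv \<sigma> x)) (\<sigma> x)) = k"
    using permutes_in_image[OF p]
    by (intro ext) (simp add: restrict_def permutes_inverses[OF p] PiE_arb[OF k])
  show "(\<lambda>x\<in>S. k (\<sigma> x)) \<in> S \<rightarrow>\<^sub>E B" "(\<lambda>x\<in>S. k (Hilbert_Choice.inv \<sigma> x)) \<in> S \<rightarrow>\<^sub>E B"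
    using PiE_mem[OF k] permutes_in_image[OF p] permutes_in_image[OF permutes_inv[OF p]]
    by (auto simp: restrict_PiE_iff)
qed simp

subsection \<open>The Fischer norm of a power of the determinant\<close>

definition row_permutations :: "'a set \<Rightarrow> nat \<Rightarrow> ('a \<times> nat \<Rightarrow> 'a \<times> nat) set" where
  "row_permutations A s = {\<theta>. \<theta> permutes A \<times> {..<s} \<and> (\<forall>x\<in>A \<times> {..<s}. fst (\<theta> x) = fst x)}"

text \<open>
  \<open>det(\<partial>)^s det^s\<close>: both powers are expanded over \<open>k : A \<times> [s] \<rightarrow> A\<close>, column \<open>j\<close> of \<open>k\<close> being the
  permutation chosen in the \<open>j\<close>-th factor, and \<open>\<theta>\<close> matches derivatives with variables of the same row.
\<close>

definition det_power_norm :: "'a set \<Rightarrow> nat \<Rightarrow> int" where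
  "det_power_norm A s = (\<Sum>k\<in>A \<times> {..<s} \<rightarrow>\<^sub>E A. colsign A {..<s} k *
     (\<Sum>\<theta>\<in>row_permutations A s. colsign A {..<s} (\<lambda>x. k (\<theta> x))))"

section \<open>Coset representatives for row permutations with one more column\<close>

definition row_swap :: "'a set \<Rightarrow> nat \<Rightarrow> ('a \<Rightarrow> nat) \<Rightarrow> 'a \<times> nat \<Rightarrow> 'a \<times> nat" where
  "row_swap A s \<phi> x = (if x \<in> A \<times> {..<Suc s}
     then (fst x, Transposition.transpose s (\<phi> (fst x)) (snd x)) else x)"

lemma colsign_cong: "(\<And>x. x \<in> A \<times> J \<Longrightarrow> k x = k' x) \<Longrightarrow> colsign A J k = colsign A J k'"
  unfolding colsign_def by (intro prod.cong refl levi_cong) auto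

lemma colsign_Suc: "colsign A {..<Suc s} k = colsign A {..<s} k * levi A (\<lambda>a. k (a, s))"
  by (simp add: colsign_def)

lemma row_swap_in:
  assumes "\<phi> \<in> A \<rightarrow> {..<Suc s}" "x \<in> A \<times> {..<Suc s}"
  shows "row_swap A s \<phi> x \<in> A \<times> {..<Suc s}" "fst (row_swap A s \<phi> x) = fst x"
proof -
  have "\<phi> (fst x) < Suc s" using assms by auto
  then show "row_swap A s \<phi> x \<in> A \<times> {..<Suc s}" "fst (row_swap A s \<phi> x) = fst x"
    using assms by (auto simp: row_swap_def Transposition.transpose_def)
qed

lemma row_swap_involution:
  assumes "\<phi> \<in> A \<rightarrow> {..<Suc s}"
  shows "row_swap A s \<phi> (row_swap A s \<phi> x) = x"
proof (cases "x \<in> A \<times> {..<Suc s}")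
  case True
  then show ?thesis
    using row_swap_in[OF assms True] by (simp add: row_swap_def[of A s \<phi> x] row_swap_def[of A s \<phi> "(_, _)"])
qed (simp add: row_swap_def)

lemma row_swap_permutes:
  assumes "\<phi> \<in> A \<rightarrow> {..<Suc s}"
  shows "row_swap A s \<phi> permutes A \<times> {..<Suc s}"
  using row_swap_involution[OF assms] row_swap_in[OF assms]
  by (intro bij_imp_permutes bij_betwI[where g = "row_swap A s \<phi>"]) (auto simp: row_swap_def)

lemma row_swap_last [simp]:
  "a \<in> A \<Longrightarrow> row_swap A s \<phi> (a, s) = (a, \<phi> a)"
  "a \<in> A \<Longrightarrow> \<phi> a < Suc s \<Longrightarrow> row_swap A s \<phi> (a, \<phi> a) = (a, s)"
  by (auto simp: row_swap_def)

text \<open>A coset decomposition: if \<open>\<phi> a\<close> is the column of the cell that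
  \<open>\<theta>\<close> sends to \<open>(a, s)\<close>, then composing \<open>\<theta>\<close>
  with the involution \<open>row_swap A s \<phi>\<close> gives a permutation fixing the last column.
  Being the identity off the grid, \<open>row_swap\<close> is a permutation in the sense of
  \<open>permutes\<close>.\<close>

lemma sum_row_permutations_Suc:
  fixes A :: "'a set"
  shows
  "(\<Sum>\<theta>\<in>row_permutations A (Suc s). F \<theta>) =
    (\<Sum>\<theta>\<in>row_permutations A s. \<Sum>\<phi>\<in>A \<rightarrow>\<^sub>E {..<Suc s}. F (\<theta> \<circ> row_swap A s \<phi>))"
proof -
  let ?P = "A \<times> {..<Suc s}"
  \<comment> \<open>The representative is read off from the preimages of the last column.\<close>
  define \<Phi> where "\<Phi> \<theta> = (\<lambda>a\<in>A. snd (Hilbert_Choice.inv \<theta> (a, s)))" for \<theta> :: "'a \<times> nat \<Rightarrow> 'a \<times> nat"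
  have "(\<Sum>\<theta>\<in>row_permutations A (Suc s). F \<theta>) =
      (\<Sum>(\<theta>, \<phi>)\<in>row_permutations A s \<times> (A \<rightarrow>\<^sub>E {..<Suc s}). F (\<theta> \<circ> row_swap A s \<phi>))"
  proof (rule sum.reindex_bij_witness[where j = "\<lambda>\<theta>. (\<theta> \<circ> row_swap A s (\<Phi> \<theta>), \<Phi> \<theta>)"
        and i = "\<lambda>(\<theta>, \<phi>). \<theta> \<circ> row_swap A s \<phi>"])
    fix \<theta> assume "\<theta> \<in> row_permutations A (Suc s)"
    then have \<theta>: "\<theta> permutes ?P" and row: "\<And>x. x \<in> ?P \<Longrightarrow> fst (\<theta> x) = fst x"
      by (auto simp: row_permutations_def)
    have \<Phi>: "\<theta> (a, \<Phi> \<theta> a) = (a, s)" "\<Phi> \<theta> a < Suc s" if a: "a \<in> A" for a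
    proof -
      define y where "y = Hilbert_Choice.inv \<theta> (a, s)"
      have y: "y \<in> ?P" "\<theta> y = (a, s)"
        using a permutes_in_image[OF permutes_inv[OF \<theta>], of "(a, s)"] permutes_inverses[OF \<theta>]
        by (auto simp: y_def)
      then have "fst y = a" using row by fastforce
      then have "y = (a, \<Phi> \<theta> a)"
        using a by (simp add: \<Phi>_def y_def[symmetric] prod_eq_iff)
      with y show "\<theta> (a, \<Phi> \<theta> a) = (a, s)" "\<Phi> \<theta> a < Suc s" by auto
    qed
    have PiE: "\<Phi> \<theta> \<in> A \<rightarrow>\<^sub>E {..<Suc s}"
      using \<Phi>(2) by (auto simp: PiE_iff \<Phi>_def)
    then have Pi: "\<Phi> \<theta> \<in> A \<rightarrow> {..<Suc s}" by auto
    have "\<theta> \<circ> row_swap A s (\<Phi> \<theta>) permutes ?P"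
      by (intro permutes_compose row_swap_permutes Pi \<theta>)
    then have "\<theta> \<circ> row_swap A s (\<Phi> \<theta>) permutes A \<times> {..<s}"
      by (rule permutes_superset) (auto simp: \<Phi> less_Suc_eq)
    moreover have "fst ((\<theta> \<circ> row_swap A s (\<Phi> \<theta>)) x) = fst x" if "x \<in> A \<times> {..<s}" for x
    proof -
      from that have "x \<in> ?P" by auto
      then show ?thesis
        using row row_swap_in[OF Pi] by simp
    qed
    ultimately show "(\<theta> \<circ> row_swap A s (\<Phi> \<theta>), \<Phi> \<theta>) \<in> row_permutations A s \<times> (A \<rightarrow>\<^sub>E {..<Suc s})"
      using PiE by (auto simp: row_permutations_def)
    show *: "(case (\<theta> \<circ> row_swap A s (\<Phi> \<theta>), \<Phi> \<theta>) of (\<theta>, \<phi>) \<Rightarrow> \<theta> \<circ> row_swap A s \<phi>) = \<theta>"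
      by (simp add: fun_eq_iff row_swap_involution[OF Pi])
    then show "(case (\<theta> \<circ> row_swap A s (\<Phi> \<theta>), \<Phi> \<theta>) of (\<theta>, \<phi>) \<Rightarrow> F (\<theta> \<circ> row_swap A s \<phi>)) = F \<theta>"
      by simp
  next
    fix x assume "x \<in> row_permutations A s \<times> (A \<rightarrow>\<^sub>E {..<Suc s})"
    then obtain \<theta> \<phi> where x: "x = (\<theta>, \<phi>)" and \<theta>: "\<theta> permutes A \<times> {..<s}"
      and row: "\<And>x. x \<in> A \<times> {..<s} \<Longrightarrow> fst (\<theta> x) = fst x" and \<phi>: "\<phi> \<in> A \<rightarrow>\<^sub>E {..<Suc s}"
      by (auto simp: row_permutations_def)
    have Pi: "\<phi> \<in> A \<rightarrow> {..<Suc s}" using \<phi> by auto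
    have \<theta>': "\<theta> permutes ?P"
      using \<theta> by (rule permutes_subset) auto
    have perm: "\<theta> \<circ> row_swap A s \<phi> permutes ?P"
      by (intro permutes_compose row_swap_permutes Pi \<theta>')
    have fst: "fst (\<theta> y) = fst y" for y
      using row permutes_not_in[OF \<theta>] by (cases "y \<in> A \<times> {..<s}") auto
    show "(case x of (\<theta>, \<phi>) \<Rightarrow> \<theta> \<circ> row_swap A s \<phi>) \<in> row_permutations A (Suc s)"
      using perm row_swap_in[OF Pi] by (simp add: x row_permutations_def fst)
    have \<Phi>: "\<Phi> (\<theta> \<circ> row_swap A s \<phi>) = \<phi>"
    proof
      fix a
      show "\<Phi> (\<theta> \<circ> row_swap A s \<phi>) a = \<phi> a"
      proof (cases "a \<in> A")
        case True
        then have "\<phi> a < Suc s" using Pi by auto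
        then have "(\<theta> \<circ> row_swap A s \<phi>) (a, \<phi> a) = (a, s)"
          using True permutes_not_in[OF \<theta>, of "(a, s)"] by simp
        then have "Hilbert_Choice.inv (\<theta> \<circ> row_swap A s \<phi>) (a, s) = (a, \<phi> a)"
          using permutes_inv_eq[OF perm] by blast
        then show ?thesis using True by (simp add: \<Phi>_def)
      qed (simp add: \<Phi>_def PiE_arb[OF \<phi>])
    qed
    have "\<theta> \<circ> row_swap A s \<phi> \<circ> row_swap A s \<phi> = \<theta>"
      by (rule ext) (simp add: row_swap_involution[OF Pi])
    then show "((case x of (\<theta>, \<phi>) \<Rightarrow> \<theta> \<circ> row_swap A s \<phi>) \<circ> row_swap A s (\<Phi> (case x of (\<theta>, \<phi>) \<Rightarrow> \<theta> \<circ> row_swap A s \<phi>)),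
        \<Phi> (case x of (\<theta>, \<phi>) \<Rightarrow> \<theta> \<circ> row_swap A s \<phi>)) = x"
      by (simp only: x prod.case \<Phi>)
  qed
  then show ?thesis
    by (simp only: sum.cartesian_product)
qed

section \<open>Splitting off the last column\<close>

definition append_column :: "'a set \<Rightarrow> nat \<Rightarrow> ('a \<times> nat \<Rightarrow> 'a) \<Rightarrow> ('a \<Rightarrow> 'a) \<Rightarrow> 'a \<times> nat \<Rightarrow> 'a" where
  "append_column A s k m = (\<lambda>x\<in>A \<times> {..<Suc s}. if snd x = s then m (fst x) else k x)"

lemma sum_append_column:
  "(\<Sum>k\<in>A \<times> {..<Suc s} \<rightarrow>\<^sub>E A. F k) =
    (\<Sum>k\<in>A \<times> {..<s} \<rightarrow>\<^sub>E A. \<Sum>m\<in>A \<rightarrow>\<^sub>E A. F (append_column A s k m))"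
proof -
  have "(\<Sum>k\<in>A \<times> {..<Suc s} \<rightarrow>\<^sub>E A. F k) =
      (\<Sum>(k, m)\<in>(A \<times> {..<s} \<rightarrow>\<^sub>E A) \<times> (A \<rightarrow>\<^sub>E A). F (append_column A s k m))"
  proof (rule sum.reindex_bij_witness[where j = "\<lambda>k. (restrict k (A \<times> {..<s}), \<lambda>a\<in>A. k (a, s))"
        and i = "\<lambda>(k, m). append_column A s k m"])
    fix k assume k: "k \<in> A \<times> {..<Suc s} \<rightarrow>\<^sub>E A"
    show *: "(case (restrict k (A \<times> {..<s}), \<lambda>a\<in>A. k (a, s)) of (k, m) \<Rightarrow> append_column A s k m) = k"
    proof
      fix x
      show "(case (restrict k (A \<times> {..<s}), \<lambda>a\<in>A. k (a, s)) of (k, m) \<Rightarrow> append_column A s k m) x = k x"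
        by (cases "x \<in> A \<times> {..<Suc s}") (auto simp: append_column_def PiE_arb[OF k])
    qed
    then show "(case (restrict k (A \<times> {..<s}), \<lambda>a\<in>A. k (a, s)) of (k, m) \<Rightarrow> F (append_column A s k m)) = F k"
      by (simp only: prod.case)
    show "(restrict k (A \<times> {..<s}), \<lambda>a\<in>A. k (a, s)) \<in> (A \<times> {..<s} \<rightarrow>\<^sub>E A) \<times> (A \<rightarrow>\<^sub>E A)"
      using PiE_mem[OF k] by (auto simp: restrict_PiE_iff)
  next
    fix x assume "x \<in> (A \<times> {..<s} \<rightarrow>\<^sub>E A) \<times> (A \<rightarrow>\<^sub>E A)"
    then obtain k m where x: "x = (k, m)" and k: "k \<in> A \<times> {..<s} \<rightarrow>\<^sub>E A" and m: "m \<in> A \<rightarrow>\<^sub>E A"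
      by auto
    have "restrict (append_column A s k m) (A \<times> {..<s}) = k"
      by (rule ext) (auto simp: append_column_def restrict_def PiE_arb[OF k])
    moreover have "(\<lambda>a\<in>A. append_column A s k m (a, s)) = m"
      by (rule ext) (auto simp: append_column_def restrict_def PiE_arb[OF m])
    ultimately show "(restrict (case x of (k, m) \<Rightarrow> append_column A s k m) (A \<times> {..<s}),
        \<lambda>a\<in>A. (case x of (k, m) \<Rightarrow> append_column A s k m) (a, s)) = x"
      by (simp add: x)
    show "(case x of (k, m) \<Rightarrow> append_column A s k m) \<in> A \<times> {..<Suc s} \<rightarrow>\<^sub>E A"
      using PiE_mem[OF k] PiE_mem[OF m] by (auto simp: x append_column_def restrict_PiE_iff)
  qed
  then show ?thesis
    by (simp only: sum.cartesian_product)
qed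

text \<open>Cayley's identity for the power \<open>s + 1\<close>: summing the parts over all
  distributions \<open>\<phi>\<close> of the row derivatives adds the stabilizer counts up to the
  rising factorial.\<close>

lemma sum_omega_part:
  fixes t :: "'a \<Rightarrow> 'a \<Rightarrow> int"
  assumes A: "finite A"
  shows "(\<Sum>\<phi>\<in>A \<rightarrow>\<^sub>E {..<Suc s}. omega_part A {..<Suc s} \<phi> t) = int (\<Prod>i<card A. Suc s + i) * ldet A t ^ s"
proof -
  have "(\<Sum>\<phi>\<in>A \<rightarrow>\<^sub>E {..<Suc s}. omega_part A {..<Suc s} \<phi> t) =
      (\<Sum>\<phi>\<in>A \<rightarrow>\<^sub>E {..<Suc s}. ldet A t ^ s * int (card {p. p permutes A \<and> (\<forall>a\<in>A. \<phi> (p a) = \<phi> a)}))"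
    using A by (intro sum.cong refl omega_part_eq) auto
  also have "\<dots> = ldet A t ^ s * int (\<Sum>\<phi>\<in>A \<rightarrow>\<^sub>E {..<Suc s}. card {p. p permutes A \<and> (\<forall>a\<in>A. \<phi> (p a) = \<phi> a)})"
    by (simp add: sum_distrib_left)
  also have "\<dots> = int (\<Prod>i<card A. Suc s + i) * ldet A t ^ s"
    by (subst sum_stabilizers[OF A]) simp_all
  finally show ?thesis .
qed

text \<open>Substituting \<open>k \<circ> row_swap A s \<phi>\<close> for \<open>k\<close> moves the
  cell \<open>(a, \<phi> a)\<close> hit by the derivative in row \<open>a\<close> to the last
  column; the involution cancels inside \<open>colsign\<close>, and the cells of the first
  \<open>s\<close> columns become those that are not hit.\<close>

lemma omega_part_row_swap:
  fixes t :: "'a \<Rightarrow> 'a \<Rightarrow> int"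
  assumes A: "finite A" and \<phi>: "\<phi> \<in> A \<rightarrow>\<^sub>E {..<Suc s}"
  shows "(\<Sum>k\<in>A \<times> {..<Suc s} \<rightarrow>\<^sub>E A. levi A (\<lambda>a. k (a, s)) *
      colsign A {..<Suc s} (\<lambda>x. k (row_swap A s \<phi> x)) * (\<Prod>x\<in>A \<times> {..<s}. t (fst x) (k x))) =
    omega_part A {..<Suc s} \<phi> t"
proof -
  let ?S = "A \<times> {..<Suc s}"
  define H where "H k = levi A (\<lambda>a. k (a, s)) * colsign A {..<Suc s} (\<lambda>x. k (row_swap A s \<phi> x)) *
      (\<Prod>x\<in>A \<times> {..<s}. t (fst x) (k x))" for k
  have Pi: "\<phi> \<in> A \<rightarrow> {..<Suc s}" using \<phi> by auto
  have "(\<Sum>k\<in>?S \<rightarrow>\<^sub>E A. H k) = (\<Sum>k\<in>?S \<rightarrow>\<^sub>E A. H (\<lambda>x\<in>?S. k (row_swap A s \<phi> x)))"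
    by (rule sum_PiE_permute[OF row_swap_permutes[OF Pi], symmetric])
  also have "\<dots> = omega_part A {..<Suc s} \<phi> t"
    unfolding omega_part_def
  proof (rule sum.cong[OF refl])
    fix k assume "k \<in> ?S \<rightarrow>\<^sub>E A"
    have 1: "levi A (\<lambda>a. (\<lambda>x\<in>?S. k (row_swap A s \<phi> x)) (a, s)) = levi A (\<lambda>a. k (a, \<phi> a))"
      by (intro levi_cong) simp
    have 2: "colsign A {..<Suc s} (\<lambda>x. (\<lambda>x\<in>?S. k (row_swap A s \<phi> x)) (row_swap A s \<phi> x)) = colsign A {..<Suc s} k"
      by (intro colsign_cong) (simp only: restrict_apply' row_swap_in[OF Pi] row_swap_involution[OF Pi])
    have "(\<Prod>x\<in>A \<times> {..<s}. t (fst x) ((\<lambda>x\<in>?S. k (row_swap A s \<phi> x)) x)) =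
        (\<Prod>a\<in>A. \<Prod>j<s. t a (k (a, Transposition.transpose s (\<phi> a) j)))"
      unfolding prod.cartesian_product
      by (intro prod.cong refl) (auto simp: row_swap_def)
    also have "\<dots> = (\<Prod>a\<in>A. \<Prod>j\<in>{..<Suc s} - {\<phi> a}. t a (k (a, j)))"
    proof (rule prod.cong[OF refl])
      fix a assume "a \<in> A"
      then have "\<phi> a < Suc s" using Pi by auto
      then have "bij_betw (Transposition.transpose s (\<phi> a)) {..<s} ({..<Suc s} - {\<phi> a})"
        by (intro bij_betwI[where g = "Transposition.transpose s (\<phi> a)"])
          (auto simp: Transposition.transpose_def)
      then show "(\<Prod>j<s. t a (k (a, Transposition.transpose s (\<phi> a) j))) = (\<Prod>j\<in>{..<Suc s} - {\<phi> a}. t a (k (a, j)))"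
        by (rule prod.reindex_bij_betw)
    qed
    finally show "H (\<lambda>x\<in>?S. k (row_swap A s \<phi> x)) =
        of_int (colsign A {..<Suc s} k * levi A (\<lambda>a. k (a, \<phi> a))) * (\<Prod>a\<in>A. \<Prod>j\<in>{..<Suc s} - {\<phi> a}. t a (k (a, j)))"
      unfolding H_def 1 2 by simp
  qed
  finally show ?thesis
    by (simp only: H_def)
qed

lemma append_column_last: "a \<in> A \<Longrightarrow> append_column A s k m (a, s) = m a"
  by (simp add: append_column_def)

lemma append_column_less: "x \<in> A \<times> {..<s} \<Longrightarrow> append_column A s k m x = k x"
  by (auto simp: append_column_def)

text \<open>One factor \<open>det(\<partial>)\<close> is applied to \<open>det^(s + 1)\<close> and
  evaluated by Cayley's identity. The identity compares polynomials, not coefficients of words,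
  since several words give the same monomial; but the norm sums over row permutations, and such
  symmetrized coefficients do agree.\<close>

lemma det_power_norm_Suc:
  assumes A: "finite A"
  shows "det_power_norm A (Suc s) = int (\<Prod>i<card A. Suc s + i) * det_power_norm A s"
proof -
  let ?P = "A \<times> {..<s}" and ?\<Phi> = "A \<rightarrow>\<^sub>E {..<Suc s}" and ?C = "int (\<Prod>i<card A. Suc s + i)"
  define c where "c w m \<phi> = colsign A {..<Suc s} (\<lambda>x. append_column A s w m (row_swap A s \<phi> x))" for w m \<phi>
  \<comment> \<open>The coefficient collected at the word \<open>w\<close> in
    \<open>det(\<partial>) det^(s + 1)\<close>: \<open>m\<close> is the self-map chosen in
    \<open>det(\<partial>)\<close>, and \<open>\<phi> a\<close> is the factor hit by its derivative
    in row \<open>a\<close>.\<close>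
  define L where "L w = (\<Sum>m\<in>A \<rightarrow>\<^sub>E A. levi A m * (\<Sum>\<phi>\<in>?\<Phi>. c w m \<phi>))" for w
  \<comment> \<open>Recombining \<open>w\<close> and \<open>m\<close> into one \<open>k\<close> and
    summing over \<open>k\<close> first produces the parts \<open>omega_part\<close> one by
    one.\<close>
  have eval: "(\<Sum>w\<in>?P \<rightarrow>\<^sub>E A. L w * (\<Prod>x\<in>?P. t (fst x) (w x))) =
      (\<Sum>w\<in>?P \<rightarrow>\<^sub>E A. (?C * colsign A {..<s} w) * (\<Prod>x\<in>?P. t (fst x) (w x)))" for t :: "'a \<Rightarrow> 'a \<Rightarrow> int"
  proof -
    define H where "H \<phi> k = levi A (\<lambda>a. k (a, s)) * colsign A {..<Suc s} (\<lambda>x. k (row_swap A s \<phi> x)) *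
      (\<Prod>x\<in>?P. t (fst x) (k x))" for \<phi> k
    have H: "H \<phi> (append_column A s w m) = levi A m * c w m \<phi> * (\<Prod>x\<in>?P. t (fst x) (w x))" for \<phi> w m
    proof -
      have "levi A (\<lambda>a. append_column A s w m (a, s)) = levi A m"
        by (intro levi_cong append_column_last)
      moreover have "(\<Prod>x\<in>?P. t (fst x) (append_column A s w m x)) = (\<Prod>x\<in>?P. t (fst x) (w x))"
        by (intro prod.cong refl) (simp only: append_column_less)
      ultimately show ?thesis
        by (simp only: H_def c_def)
    qed
    have "(\<Sum>w\<in>?P \<rightarrow>\<^sub>E A. L w * (\<Prod>x\<in>?P. t (fst x) (w x))) =
        (\<Sum>w\<in>?P \<rightarrow>\<^sub>E A. \<Sum>m\<in>A \<rightarrow>\<^sub>E A. \<Sum>\<phi>\<in>?\<Phi>. H \<phi> (append_column A s w m))"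
      unfolding H L_def sum_distrib_left sum_distrib_right ..
    also have "\<dots> = (\<Sum>k\<in>A \<times> {..<Suc s} \<rightarrow>\<^sub>E A. \<Sum>\<phi>\<in>?\<Phi>. H \<phi> k)"
      by (rule sum_append_column[symmetric])
    also have "\<dots> = (\<Sum>\<phi>\<in>?\<Phi>. \<Sum>k\<in>A \<times> {..<Suc s} \<rightarrow>\<^sub>E A. H \<phi> k)"
      by (rule sum.swap)
    also have "\<dots> = (\<Sum>\<phi>\<in>?\<Phi>. omega_part A {..<Suc s} \<phi> t)"
      unfolding H_def by (intro sum.cong refl omega_part_row_swap A)
    also have "\<dots> = ?C * (\<Prod>j\<in>{..<s}. ldet A t)"
      by (simp add: sum_omega_part[OF A] del: prod.lessThan_Suc of_nat_prod)
    also have "\<dots> = ?C * (\<Sum>w\<in>?P \<rightarrow>\<^sub>E A. colsign A {..<s} w * (\<Prod>x\<in>?P. t (fst x) (w x)))"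
      unfolding prod_ldet[OF A finite_lessThan] by (simp add: prod.cartesian_product case_prod_unfold)
    finally show ?thesis
      by (simp only: sum_distrib_left mult.assoc)
  qed
  have "det_power_norm A (Suc s) = (\<Sum>k\<in>?P \<rightarrow>\<^sub>E A. \<Sum>m\<in>A \<rightarrow>\<^sub>E A.
      colsign A {..<s} k * levi A m * (\<Sum>\<theta>\<in>row_permutations A s. \<Sum>\<phi>\<in>?\<Phi>. c (\<lambda>x\<in>?P. k (\<theta> x)) m \<phi>))"
    unfolding det_power_norm_def sum_append_column sum_row_permutations_Suc
  proof (rule sum.cong[OF refl], rule sum.cong[OF refl], rule arg_cong2[where f = "(*)"])
    fix k m
    have "levi A (\<lambda>a. append_column A s k m (a, s)) = levi A m"
      by (intro levi_cong append_column_last)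
    moreover have "colsign A {..<s} (append_column A s k m) = colsign A {..<s} k"
      by (intro colsign_cong append_column_less)
    ultimately show "colsign A {..<Suc s} (append_column A s k m) = colsign A {..<s} k * levi A m"
      by (simp only: colsign_Suc)
    show "(\<Sum>\<theta>\<in>row_permutations A s. \<Sum>\<phi>\<in>?\<Phi>.
        colsign A {..<Suc s} (\<lambda>x. append_column A s k m ((\<theta> \<circ> row_swap A s \<phi>) x))) =
        (\<Sum>\<theta>\<in>row_permutations A s. \<Sum>\<phi>\<in>?\<Phi>. c (\<lambda>x\<in>?P. k (\<theta> x)) m \<phi>)"
    proof (rule sum.cong[OF refl], rule sum.cong[OF refl])
      fix \<theta> \<phi> assume "\<theta> \<in> row_permutations A s" and \<phi>: "\<phi> \<in> ?\<Phi>"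
      then have \<theta>: "\<theta> permutes ?P" by (simp add: row_permutations_def)
      have Pi: "\<phi> \<in> A \<rightarrow> {..<Suc s}" using \<phi> by auto
      \<comment> \<open>As \<open>\<theta>\<close> fixes the last column, it acts on
        \<open>k\<close> alone and leaves \<open>m\<close> untouched.\<close>
      have "append_column A s k m (\<theta> y) = append_column A s (\<lambda>x\<in>?P. k (\<theta> x)) m y"
        if y: "y \<in> A \<times> {..<Suc s}" for y
      proof (cases "y \<in> ?P")
        case True
        then show ?thesis
          using permutes_in_image[OF \<theta>] by (simp only: append_column_less restrict_apply')
      next
        case False
        then have "snd y = s" using y by auto
        with y show ?thesis
          by (simp add: permutes_not_in[OF \<theta> False] append_column_def)
      qed
      then show "colsign A {..<Suc s} (\<lambda>x. append_column A s k m ((\<theta> \<circ> row_swap A s \<phi>) x)) =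
          c (\<lambda>x\<in>?P. k (\<theta> x)) m \<phi>"
        unfolding c_def using row_swap_in(1)[OF Pi] by (intro colsign_cong) (simp only: comp_apply)
    qed
  qed
  also have "\<dots> = (\<Sum>k\<in>?P \<rightarrow>\<^sub>E A. colsign A {..<s} k * (\<Sum>\<theta>\<in>row_permutations A s. L (\<lambda>x\<in>?P. k (\<theta> x))))"
  proof (rule sum.cong[OF refl])
    fix k
    have "(\<Sum>\<theta>\<in>row_permutations A s. L (\<lambda>x\<in>?P. k (\<theta> x))) =
        (\<Sum>m\<in>A \<rightarrow>\<^sub>E A. levi A m * (\<Sum>\<theta>\<in>row_permutations A s. \<Sum>\<phi>\<in>?\<Phi>. c (\<lambda>x\<in>?P. k (\<theta> x)) m \<phi>))"
      unfolding L_def sum_distrib_left by (rule sum.swap)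
    then show "(\<Sum>m\<in>A \<rightarrow>\<^sub>E A. colsign A {..<s} k * levi A m *
          (\<Sum>\<theta>\<in>row_permutations A s. \<Sum>\<phi>\<in>?\<Phi>. c (\<lambda>x\<in>?P. k (\<theta> x)) m \<phi>)) =
        colsign A {..<s} k * (\<Sum>\<theta>\<in>row_permutations A s. L (\<lambda>x\<in>?P. k (\<theta> x)))"
      by (simp only: sum_distrib_left mult.assoc)
  qed
  also have "\<dots> = (\<Sum>k\<in>?P \<rightarrow>\<^sub>E A. colsign A {..<s} k *
      (\<Sum>\<theta>\<in>row_permutations A s. ?C * colsign A {..<s} (\<lambda>x\<in>?P. k (\<theta> x))))"
  proof (rule sum.cong[OF refl], rule arg_cong2[where f = "(*)", OF refl])
    fix k assume "k \<in> ?P \<rightarrow>\<^sub>E A"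
    then have "k \<in> ?P \<rightarrow> A" by auto
    from polarization[where \<rho> = fst, OF _ A this eval] A
    show "(\<Sum>\<theta>\<in>row_permutations A s. L (\<lambda>x\<in>?P. k (\<theta> x))) =
        (\<Sum>\<theta>\<in>row_permutations A s. ?C * colsign A {..<s} (\<lambda>x\<in>?P. k (\<theta> x)))"
      unfolding row_permutations_def by blast
  qed
  also have "\<dots> = ?C * det_power_norm A s"
  proof -
    have "colsign A {..<s} (\<lambda>x\<in>?P. k (\<theta> x)) = colsign A {..<s} (\<lambda>x. k (\<theta> x))" for k :: "'a \<times> nat \<Rightarrow> 'a" and \<theta>
      by (intro colsign_cong) (simp only: restrict_apply')
    then show ?thesis
      unfolding det_power_norm_def sum_distrib_left by (simp only: mult.left_commute)
  qed
  finally show ?thesis .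
qed

lemma det_power_norm_eq:
  assumes A: "finite A"
  shows "det_power_norm A s = int (\<Prod>j<s. \<Prod>i<card A. Suc j + i)"
proof (induction s)
  case 0
  have "row_permutations A 0 = {id}"
    by (auto simp: row_permutations_def)
  then show ?case
    by (simp add: det_power_norm_def colsign_def)
qed (simp add: det_power_norm_Suc[OF A] del: of_nat_prod)

subsection \<open>The matrix of pair signs\<close>

definition pair_sign :: "'a set \<Rightarrow> ('a \<times> 'a \<Rightarrow> 'a) \<Rightarrow> ('a \<times> 'a \<Rightarrow> 'a) \<Rightarrow> int" where
  "pair_sign A f g = levi (A \<times> A) (\<lambda>x. (f x, g x))"

lemma pair_sign_cong:
  "(\<And>x. x \<in> A \<times> A \<Longrightarrow> f x = f' x) \<Longrightarrow> (\<And>x. x \<in> A \<times> A \<Longrightarrow> g x = g' x) \<Longrightarrow>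
    pair_sign A f g = pair_sign A f' g'"
  unfolding pair_sign_def by (intro levi_cong) auto

lemma pair_sign_permute:
  assumes "finite A" "\<pi> permutes A \<times> A" "f \<in> A \<times> A \<rightarrow> A" "g \<in> A \<times> A \<rightarrow> A"
  shows "pair_sign A (\<lambda>x. f (\<pi> x)) (\<lambda>x. g (\<pi> x)) = sign \<pi> * pair_sign A f g"
proof -
  have "levi (A \<times> A) (\<lambda>x. (\<lambda>x. (f x, g x)) (\<pi> x)) = levi (A \<times> A) (\<lambda>x. (f x, g x)) * levi (A \<times> A) \<pi>"
    using assms permutes_in_image[OF assms(2)] by (intro levi_compose) auto
  then show ?thesis
    by (simp add: pair_sign_def levi_permutes[OF assms(2)])
qed

text \<open>This sign decides whether the matrix of pair signs is symmetric or antisymmetric, and is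
  the source of the sign left open in the theorem.\<close>

definition swap_sign :: "'a set \<Rightarrow> int" where
  "swap_sign A = levi (A \<times> A) prod.swap"

lemma swap_sign_square: "swap_sign A * swap_sign A = 1"
proof -
  have "bij_betw prod.swap (A \<times> A) (A \<times> A)"
    by (intro bij_betwI[where g = prod.swap]) auto
  then show ?thesis
    by (simp add: swap_sign_def levi_square)
qed

lemma pair_sign_swap:
  assumes "finite A" "f \<in> A \<times> A \<rightarrow> A" "g \<in> A \<times> A \<rightarrow> A"
  shows "pair_sign A g f = swap_sign A * pair_sign A f g"
proof -
  have "levi (A \<times> A) (\<lambda>x. prod.swap ((\<lambda>x. (f x, g x)) x)) =
      levi (A \<times> A) prod.swap * levi (A \<times> A) (\<lambda>x. (f x, g x))"
    using assms by (intro levi_compose) auto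
  then show ?thesis
    by (simp add: pair_sign_def swap_sign_def)
qed

section \<open>The cube of the matrix of pair signs\<close>

definition pair_sign3 :: "'a set \<Rightarrow> ('a \<times> 'a \<Rightarrow> 'a) \<Rightarrow> ('a \<times> 'a \<Rightarrow> 'a) \<Rightarrow> int" where
  "pair_sign3 A f g = (\<Sum>h\<in>A \<times> A \<rightarrow>\<^sub>E A. \<Sum>k\<in>A \<times> A \<rightarrow>\<^sub>E A.
     pair_sign A f h * pair_sign A h k * pair_sign A k g)"

lemma pair_sign3_cong:
  assumes "\<And>x. x \<in> A \<times> A \<Longrightarrow> f x = f' x" "\<And>x. x \<in> A \<times> A \<Longrightarrow> g x = g' x"
  shows "pair_sign3 A f g = pair_sign3 A f' g'"
  unfolding pair_sign3_def
  using assms by (intro sum.cong refl arg_cong2[where f = "(*)"] pair_sign_cong) auto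

text \<open>Composing both intermediate indices with \<open>\<pi>\<close> as well only reindexes the
  sums; each of the three factors then yields \<open>sign \<pi>\<close>, and the cube of a sign is
  the sign.\<close>

lemma pair_sign3_permute:
  assumes A: "finite A" and \<pi>: "\<pi> permutes A \<times> A" and f: "f \<in> A \<times> A \<rightarrow> A" and g: "g \<in> A \<times> A \<rightarrow> A"
  shows "pair_sign3 A (\<lambda>x. f (\<pi> x)) (\<lambda>x. g (\<pi> x)) = sign \<pi> * pair_sign3 A f g"
proof -
  let ?W = "A \<times> A \<rightarrow>\<^sub>E A" and ?r = "\<lambda>h. \<lambda>x\<in>A \<times> A. h (\<pi> x)"
  have "pair_sign3 A (\<lambda>x. f (\<pi> x)) (\<lambda>x. g (\<pi> x)) = (\<Sum>h\<in>?W. \<Sum>k\<in>?W.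
      pair_sign A (\<lambda>x. f (\<pi> x)) (?r h) * pair_sign A (?r h) (?r k) * pair_sign A (?r k) (\<lambda>x. g (\<pi> x)))"
    unfolding pair_sign3_def
    by (subst sum_PiE_permute[OF \<pi>, symmetric], rule sum.cong[OF refl],
        subst sum_PiE_permute[OF \<pi>, symmetric]) (rule refl)
  also have "\<dots> = (\<Sum>h\<in>?W. \<Sum>k\<in>?W. sign \<pi> * (pair_sign A f h * pair_sign A h k * pair_sign A k g))"
  proof (rule sum.cong[OF refl], rule sum.cong[OF refl])
    fix h k assume "h \<in> ?W" "k \<in> ?W"
    then have h: "h \<in> A \<times> A \<rightarrow> A" and k: "k \<in> A \<times> A \<rightarrow> A" by auto
    have "pair_sign A (\<lambda>x. f (\<pi> x)) (?r h) = sign \<pi> * pair_sign A f h"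
      unfolding pair_sign_permute[OF A \<pi> f h, symmetric] by (intro pair_sign_cong) simp_all
    moreover have "pair_sign A (?r h) (?r k) = sign \<pi> * pair_sign A h k"
      unfolding pair_sign_permute[OF A \<pi> h k, symmetric] by (intro pair_sign_cong) simp_all
    moreover have "pair_sign A (?r k) (\<lambda>x. g (\<pi> x)) = sign \<pi> * pair_sign A k g"
      unfolding pair_sign_permute[OF A \<pi> k g, symmetric] by (intro pair_sign_cong) simp_all
    ultimately show "pair_sign A (\<lambda>x. f (\<pi> x)) (?r h) * pair_sign A (?r h) (?r k) *
        pair_sign A (?r k) (\<lambda>x. g (\<pi> x)) = sign \<pi> * (pair_sign A f h * pair_sign A h k * pair_sign A k g)"
      by simp
  qed
  also have "\<dots> = sign \<pi> * pair_sign3 A f g"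
    by (simp only: pair_sign3_def sum_distrib_left)
  finally show ?thesis .
qed

text \<open>A bijective pair \<open>(f, g)\<close> arises from \<open>(fst, snd)\<close> by
  composition with a permutation, so equivariance settles it. For any other pair some transposition
  leaves \<open>f\<close> and \<open>g\<close> unchanged while changing the sign, so both sides
  vanish.\<close>

lemma pair_sign3_eq:
  assumes A: "finite A" and f: "f \<in> A \<times> A \<rightarrow> A" and g: "g \<in> A \<times> A \<rightarrow> A"
  shows "pair_sign3 A f g = pair_sign3 A fst snd * pair_sign A f g"
proof (cases "bij_betw (\<lambda>x. (f x, g x)) (A \<times> A) (A \<times> A)")
  case True
  define \<pi> where "\<pi> = restrict_id (\<lambda>x. (f x, g x)) (A \<times> A)"
  have \<pi>: "\<pi> permutes A \<times> A"
    unfolding \<pi>_def using True by (rule permutes_restrict_id)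
  have "pair_sign3 A f g = pair_sign3 A (\<lambda>x. fst (\<pi> x)) (\<lambda>x. snd (\<pi> x))"
    by (intro pair_sign3_cong) (simp_all add: \<pi>_def)
  also have "\<dots> = sign \<pi> * pair_sign3 A fst snd"
    by (rule pair_sign3_permute[OF A \<pi>]) auto
  also have "sign \<pi> = pair_sign A f g"
    using True by (simp add: pair_sign_def levi_def sign_on_def \<pi>_def)
  finally show ?thesis by simp
next
  case False
  have "(\<lambda>x. (f x, g x)) ` (A \<times> A) \<subseteq> A \<times> A"
    using f g by auto
  then have "\<not> inj_on (\<lambda>x. (f x, g x)) (A \<times> A)"
    using False A endo_inj_surj[of "A \<times> A" "\<lambda>x. (f x, g x)"] by (auto simp: bij_betw_def)
  then obtain x y where xy: "x \<in> A \<times> A" "y \<in> A \<times> A" "x \<noteq> y" "f x = f y" "g x = g y"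
    unfolding inj_on_def by blast
  define t where "t = Transposition.transpose x y"
  have t: "t permutes A \<times> A" "sign t = -1" "\<And>z. f (t z) = f z" "\<And>z. g (t z) = g z"
    using xy by (auto simp: t_def permutes_swap_id sign_swap_id Transposition.transpose_def)
  have "pair_sign3 A f g = - pair_sign3 A f g"
    using pair_sign3_permute[OF A t(1) f g] by (simp add: t(2-4))
  then show ?thesis
    using False by (simp add: pair_sign_def levi_def)
qed

text \<open>The first factor \<open>pair_sign A fst h\<close> vanishes unless
  \<open>(fst, h)\<close> is a row permutation \<open>\<theta>\<close>, and the last factor is the
  column sign of \<open>k\<close>. The set \<open>A\<close> is \<open>{..<n}\<close> so that it can
  also serve as the set of columns in \<open>det_power_norm\<close>.\<close>

lemma pair_sign3_fst_snd:
  assumes A: "A = {..<n}"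
  shows "pair_sign3 A fst snd = swap_sign A * det_power_norm A n"
proof -
  let ?W = "A \<times> A \<rightarrow>\<^sub>E A"
  have fin: "finite A" using A by simp
  define F where "F h = (\<Sum>k\<in>?W. pair_sign A k h * pair_sign A k snd)" for h
  have "pair_sign3 A fst snd = swap_sign A * (\<Sum>h\<in>?W. pair_sign A fst h * F h)"
    unfolding pair_sign3_def F_def sum_distrib_left
  proof (rule sum.cong[OF refl], rule sum.cong[OF refl])
    fix h k assume "h \<in> ?W" "k \<in> ?W"
    then have "pair_sign A h k = swap_sign A * pair_sign A k h"
      using fin by (intro pair_sign_swap) auto
    then show "pair_sign A fst h * pair_sign A h k * pair_sign A k snd =
        swap_sign A * (pair_sign A fst h * (pair_sign A k h * pair_sign A k snd))"
      by (simp only: mult_ac)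
  qed
  also have "(\<Sum>h\<in>?W. pair_sign A fst h * F h) =
      (\<Sum>h | h \<in> ?W \<and> bij_betw (\<lambda>x. (fst x, h x)) (A \<times> A) (A \<times> A). pair_sign A fst h * F h)"
    using fin by (intro sum.mono_neutral_right) (auto simp: finite_PiE pair_sign_def levi_def)
  also have "\<dots> = (\<Sum>\<theta>\<in>row_permutations A n. \<Sum>k\<in>?W. colsign A A k * colsign A A (\<lambda>x. k (\<theta> x)))"
  proof (rule sum.reindex_bij_witness[where j = "\<lambda>h. restrict_id (\<lambda>x. (fst x, h x)) (A \<times> A)"
        and i = "\<lambda>\<theta>. \<lambda>x\<in>A \<times> A. snd (\<theta> x)"])
    fix h assume "h \<in> {h. h \<in> ?W \<and> bij_betw (\<lambda>x. (fst x, h x)) (A \<times> A) (A \<times> A)}"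
    then have h: "h \<in> ?W" and bij: "bij_betw (\<lambda>x. (fst x, h x)) (A \<times> A) (A \<times> A)" by auto
    define \<theta> where "\<theta> = restrict_id (\<lambda>x. (fst x, h x)) (A \<times> A)"
    have \<theta>: "\<theta> permutes A \<times> A"
      unfolding \<theta>_def using bij by (rule permutes_restrict_id)
    show "(\<lambda>x\<in>A \<times> A. snd (restrict_id (\<lambda>x. (fst x, h x)) (A \<times> A) x)) = h"
      by (rule ext) (simp add: restrict_def PiE_arb[OF h])
    show "restrict_id (\<lambda>x. (fst x, h x)) (A \<times> A) \<in> row_permutations A n"
      using \<theta> by (simp add: row_permutations_def A \<theta>_def)
    have sign: "pair_sign A fst h = sign \<theta>"
      using bij by (simp add: pair_sign_def levi_def sign_on_def \<theta>_def)
    have col: "pair_sign A k snd = colsign A A k" if "k \<in> A \<times> A \<rightarrow> A" for k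
      unfolding pair_sign_def colsign_def using fin fin that by (rule levi_columns)
    \<comment> \<open>Replacing \<open>k\<close> by \<open>k \<circ> \<theta>\<close> helps because
      \<open>h\<close> is \<open>snd \<circ> \<theta>\<close>: the first factor becomes
      \<open>sign \<theta>\<close> times a column sign, and this sign cancels against
      \<open>pair_sign A fst h\<close>.\<close>
    have "F h = (\<Sum>k\<in>?W. pair_sign A (\<lambda>x\<in>A \<times> A. k (\<theta> x)) h * pair_sign A (\<lambda>x\<in>A \<times> A. k (\<theta> x)) snd)"
      unfolding F_def by (rule sum_PiE_permute[OF \<theta>, symmetric])
    also have "\<dots> = (\<Sum>k\<in>?W. sign \<theta> * (colsign A A k * colsign A A (\<lambda>x. k (\<theta> x))))"
    proof (rule sum.cong[OF refl])
      fix k assume "k \<in> ?W"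
      then have k: "k \<in> A \<times> A \<rightarrow> A" by auto
      have k\<theta>: "(\<lambda>x. k (\<theta> x)) \<in> A \<times> A \<rightarrow> A"
        using k permutes_in_image[OF \<theta>] by auto
      have "pair_sign A (\<lambda>x\<in>A \<times> A. k (\<theta> x)) h = pair_sign A (\<lambda>x. k (\<theta> x)) (\<lambda>x. snd (\<theta> x))"
        by (intro pair_sign_cong) (simp_all add: \<theta>_def)
      also have "\<dots> = sign \<theta> * pair_sign A k snd"
        by (rule pair_sign_permute[OF fin \<theta> k]) auto
      finally have "pair_sign A (\<lambda>x\<in>A \<times> A. k (\<theta> x)) h = sign \<theta> * colsign A A k"
        by (simp only: col[OF k])
      moreover have "pair_sign A (\<lambda>x\<in>A \<times> A. k (\<theta> x)) snd = colsign A A (\<lambda>x. k (\<theta> x))"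
        unfolding col[OF k\<theta>, symmetric] by (intro pair_sign_cong) simp_all
      ultimately show "pair_sign A (\<lambda>x\<in>A \<times> A. k (\<theta> x)) h * pair_sign A (\<lambda>x\<in>A \<times> A. k (\<theta> x)) snd =
          sign \<theta> * (colsign A A k * colsign A A (\<lambda>x. k (\<theta> x)))"
        by (simp only: mult.assoc)
    qed
    finally have "F h = sign \<theta> * (\<Sum>k\<in>?W. colsign A A k * colsign A A (\<lambda>x. k (\<theta> x)))"
      by (simp only: sum_distrib_left)
    then show "(\<Sum>k\<in>?W. colsign A A k * colsign A A (\<lambda>x. k (restrict_id (\<lambda>x. (fst x, h x)) (A \<times> A) x))) =
        pair_sign A fst h * F h"
      by (simp add: sign mult.assoc[symmetric] flip: \<theta>_def)
  next
    fix \<theta> assume "\<theta> \<in> row_permutations A n"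
    then have \<theta>: "\<theta> permutes A \<times> A" and row: "\<And>x. x \<in> A \<times> A \<Longrightarrow> fst (\<theta> x) = fst x"
      by (auto simp: row_permutations_def A)
    have eq: "(fst x, (\<lambda>x\<in>A \<times> A. snd (\<theta> x)) x) = \<theta> x" if "x \<in> A \<times> A" for x
      using that row by (simp add: prod_eq_iff)
    show "restrict_id (\<lambda>x. (fst x, (\<lambda>x\<in>A \<times> A. snd (\<theta> x)) x)) (A \<times> A) = \<theta>"
    proof
      fix x
      show "restrict_id (\<lambda>x. (fst x, (\<lambda>x\<in>A \<times> A. snd (\<theta> x)) x)) (A \<times> A) x = \<theta> x"
        by (cases "x \<in> A \<times> A") (simp_all only: restrict_id_simps(1) eq, simp add: permutes_not_in[OF \<theta>])
    qed
    have "bij_betw (\<lambda>x. (fst x, (\<lambda>x\<in>A \<times> A. snd (\<theta> x)) x)) (A \<times> A) (A \<times> A)"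
      using permutes_imp_bij[OF \<theta>] by (subst bij_betw_cong[OF eq])
    moreover have "(\<lambda>x\<in>A \<times> A. snd (\<theta> x)) \<in> ?W"
      using permutes_in_image[OF \<theta>] by (fastforce simp: restrict_PiE_iff mem_Times_iff)
    ultimately show "(\<lambda>x\<in>A \<times> A. snd (\<theta> x)) \<in> {h. h \<in> ?W \<and> bij_betw (\<lambda>x. (fst x, h x)) (A \<times> A) (A \<times> A)}"
      by blast
  qed
  also have "\<dots> = det_power_norm A n"
    unfolding det_power_norm_def A sum_distrib_left by (rule sum.swap)
  finally show ?thesis .
qed

subsection \<open>Traces of powers\<close>

text \<open>At most one permutation has the components \<open>f\<close> and \<open>g\<close>. In
  this form, products of pair signs expand into sums over tuples of permutations, as in the
  hyperdeterminant.\<close>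

lemma pair_sign_eq_sum_permutes:
  assumes "finite A"
  shows "pair_sign A f g =
    (\<Sum>\<sigma> | \<sigma> permutes A \<times> A. sign \<sigma> * of_bool (\<forall>x\<in>A \<times> A. fst (\<sigma> x) = f x \<and> snd (\<sigma> x) = g x))"
proof (cases "bij_betw (\<lambda>x. (f x, g x)) (A \<times> A) (A \<times> A)")
  case True
  define \<pi> where "\<pi> = restrict_id (\<lambda>x. (f x, g x)) (A \<times> A)"
  have \<pi>: "\<pi> permutes A \<times> A"
    unfolding \<pi>_def using True by (rule permutes_restrict_id)
  have iff: "(\<forall>x\<in>A \<times> A. fst (\<sigma> x) = f x \<and> snd (\<sigma> x) = g x) \<longleftrightarrow> \<sigma> = \<pi>" if "\<sigma> permutes A \<times> A" for \<sigma>
  proof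
    assume *: "\<forall>x\<in>A \<times> A. fst (\<sigma> x) = f x \<and> snd (\<sigma> x) = g x"
    show "\<sigma> = \<pi>"
    proof
      fix x show "\<sigma> x = \<pi> x"
        using * permutes_not_in[OF that, of x] by (cases "x \<in> A \<times> A") (auto simp: \<pi>_def prod_eq_iff)
    qed
  next
    assume "\<sigma> = \<pi>"
    then show "\<forall>x\<in>A \<times> A. fst (\<sigma> x) = f x \<and> snd (\<sigma> x) = g x"
      by (simp add: \<pi>_def)
  qed
  have "(\<Sum>\<sigma> | \<sigma> permutes A \<times> A. sign \<sigma> * of_bool (\<forall>x\<in>A \<times> A. fst (\<sigma> x) = f x \<and> snd (\<sigma> x) = g x)) =
      (\<Sum>\<sigma> | \<sigma> permutes A \<times> A. if \<sigma> = \<pi> then sign \<pi> else 0)"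
    by (rule sum.cong[OF refl]) (simp only: iff mem_Collect_eq, simp)
  also have "\<dots> = sign \<pi>"
    using \<pi> assms by (simp add: sum.delta finite_permutations)
  also have "sign \<pi> = pair_sign A f g"
    using True by (simp add: pair_sign_def levi_def sign_on_def \<pi>_def)
  finally show ?thesis by simp
next
  case False
  have no: "\<not> (\<forall>x\<in>A \<times> A. fst (\<sigma> x) = f x \<and> snd (\<sigma> x) = g x)" if "\<sigma> permutes A \<times> A" for \<sigma>
  proof
    assume "\<forall>x\<in>A \<times> A. fst (\<sigma> x) = f x \<and> snd (\<sigma> x) = g x"
    then have "(f x, g x) = \<sigma> x" if "x \<in> A \<times> A" for x
      using that by (auto simp: prod_eq_iff)
    then show False
      using False permutes_imp_bij[OF that] bij_betw_cong[of "A \<times> A" "\<lambda>x. (f x, g x)" \<sigma> "A \<times> A"] by blast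
  qed
  have "(\<Sum>\<sigma> | \<sigma> permutes A \<times> A. sign \<sigma> * of_bool (\<forall>x\<in>A \<times> A. fst (\<sigma> x) = f x \<and> snd (\<sigma> x) = g x)) = 0"
    by (intro sum.neutral ballI) (simp only: no mem_Collect_eq of_bool_eq mult_zero_right)
  then show ?thesis
    using False by (simp only: pair_sign_def levi_def if_False)
qed

text \<open>Pairs \<open>(f, g)\<close> are the self-maps of \<open>A \<times> A\<close>, and the
  squared sign is the indicator of the bijective ones.\<close>

lemma sum_pair_sign_square:
  assumes "finite A"
  shows "(\<Sum>f\<in>A \<times> A \<rightarrow>\<^sub>E A. \<Sum>g\<in>A \<times> A \<rightarrow>\<^sub>E A. pair_sign A f g * pair_sign A f g) = fact (card (A \<times> A))"
proof -
  let ?W = "A \<times> A \<rightarrow>\<^sub>E A"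
  have "(\<Sum>f\<in>?W. \<Sum>g\<in>?W. pair_sign A f g * pair_sign A f g) =
      (\<Sum>(f, g)\<in>?W \<times> ?W. pair_sign A f g * pair_sign A f g)"
    by (rule sum.cartesian_product)
  also have "\<dots> = (\<Sum>u\<in>A \<times> A \<rightarrow>\<^sub>E A \<times> A. levi (A \<times> A) u * levi (A \<times> A) u)"
  proof (rule sum.reindex_bij_witness[where j = "\<lambda>(f, g). \<lambda>x\<in>A \<times> A. (f x, g x)"
        and i = "\<lambda>u. (\<lambda>x\<in>A \<times> A. fst (u x), \<lambda>x\<in>A \<times> A. snd (u x))"])
    fix p assume "p \<in> ?W \<times> ?W"
    then obtain f g where p: "p = (f, g)" and f: "f \<in> ?W" and g: "g \<in> ?W" by auto
    show "(\<lambda>x\<in>A \<times> A. fst ((case p of (f, g) \<Rightarrow> \<lambda>x\<in>A \<times> A. (f x, g x)) x),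
        \<lambda>x\<in>A \<times> A. snd ((case p of (f, g) \<Rightarrow> \<lambda>x\<in>A \<times> A. (f x, g x)) x)) = p"
      by (auto simp: p fun_eq_iff restrict_def PiE_arb[OF f] PiE_arb[OF g])
    show "(case p of (f, g) \<Rightarrow> \<lambda>x\<in>A \<times> A. (f x, g x)) \<in> A \<times> A \<rightarrow>\<^sub>E A \<times> A"
      using PiE_mem[OF f] PiE_mem[OF g] by (auto simp: p restrict_PiE_iff)
    have "levi (A \<times> A) (\<lambda>x\<in>A \<times> A. (f x, g x)) = pair_sign A f g"
      unfolding pair_sign_def by (intro levi_cong) simp
    then show "levi (A \<times> A) (case p of (f, g) \<Rightarrow> \<lambda>x\<in>A \<times> A. (f x, g x)) *
        levi (A \<times> A) (case p of (f, g) \<Rightarrow> \<lambda>x\<in>A \<times> A. (f x, g x)) =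
        (case p of (f, g) \<Rightarrow> pair_sign A f g * pair_sign A f g)"
      by (simp add: p)
  next
    fix u assume u: "u \<in> A \<times> A \<rightarrow>\<^sub>E A \<times> A"
    show "(case (\<lambda>x\<in>A \<times> A. fst (u x), \<lambda>x\<in>A \<times> A. snd (u x)) of (f, g) \<Rightarrow> \<lambda>x\<in>A \<times> A. (f x, g x)) = u"
      by (rule ext) (auto simp: restrict_def PiE_arb[OF u])
    have "fst (u x) \<in> A" "snd (u x) \<in> A" if "x \<in> A \<times> A" for x
      using PiE_mem[OF u that] by (auto simp: mem_Times_iff)
    then show "(\<lambda>x\<in>A \<times> A. fst (u x), \<lambda>x\<in>A \<times> A. snd (u x)) \<in> ?W \<times> ?W"
      by (intro SigmaI restrict_PiE_iff[THEN iffD2] ballI)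
  qed
  also have "\<dots> = (\<Sum>u | u \<in> A \<times> A \<rightarrow>\<^sub>E A \<times> A \<and> bij_betw u (A \<times> A) (A \<times> A). 1)"
    using assms by (intro sum.mono_neutral_cong_right) (auto simp: finite_PiE levi_square)
  also have "\<dots> = int (card {p. p permutes A \<times> A})"
    unfolding sum_bij_PiE_eq_sum_permutes by simp
  also have "\<dots> = fact (card (A \<times> A))"
    using assms by (simp add: card_permutations[OF refl])
  finally show ?thesis .
qed

text \<open>Entries of the powers of the matrix of pair signs; index \<open>m\<close> stands for the power \<open>m + 1\<close>.\<close>

fun path_sign :: "'a set \<Rightarrow> nat \<Rightarrow> ('a \<times> 'a \<Rightarrow> 'a) \<Rightarrow> ('a \<times> 'a \<Rightarrow> 'a) \<Rightarrow> int" where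
  "path_sign A 0 f g = pair_sign A f g"
| "path_sign A (Suc m) f g = (\<Sum>h\<in>A \<times> A \<rightarrow>\<^sub>E A. path_sign A m f h * pair_sign A h g)"

text \<open>The relation \<open>S^3 = c S\<close> multiplied on the right by further copies of
  \<open>S\<close>; the case \<open>m = 0\<close> is the relation itself.\<close>

lemma path_sign_add_2:
  assumes A: "finite A" and f: "f \<in> A \<times> A \<rightarrow> A" and "g \<in> A \<times> A \<rightarrow> A"
  shows "path_sign A (Suc (Suc m)) f g = pair_sign3 A fst snd * path_sign A m f g"
  using assms(3)
proof (induction m arbitrary: g)
  case 0
  have "path_sign A (Suc (Suc 0)) f g = pair_sign3 A f g"
    unfolding pair_sign3_def path_sign.simps sum_distrib_right by (rule sum.swap)
  then show ?case
    using pair_sign3_eq[OF A f 0] by simp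
next
  case (Suc m)
  have "path_sign A (Suc (Suc (Suc m))) f g =
      (\<Sum>h\<in>A \<times> A \<rightarrow>\<^sub>E A. path_sign A (Suc (Suc m)) f h * pair_sign A h g)"
    by (rule path_sign.simps(2))
  also have "\<dots> = (\<Sum>h\<in>A \<times> A \<rightarrow>\<^sub>E A. pair_sign3 A fst snd * path_sign A m f h * pair_sign A h g)"
  proof (rule sum.cong[OF refl])
    fix h assume "h \<in> A \<times> A \<rightarrow>\<^sub>E A"
    then have "h \<in> A \<times> A \<rightarrow> A" by auto
    from Suc.IH[OF this] show "path_sign A (Suc (Suc m)) f h * pair_sign A h g =
        pair_sign3 A fst snd * path_sign A m f h * pair_sign A h g"
      by (simp only:)
  qed
  also have "\<dots> = pair_sign3 A fst snd * path_sign A (Suc m) f g"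
    by (simp only: path_sign.simps(2) sum_distrib_left mult.assoc)
  finally show ?case .
qed

text \<open>Odd indices are even powers, so the reduction ends at \<open>S^2\<close>, which has
  index \<open>Suc 0\<close>.\<close>

lemma path_sign_odd:
  assumes "finite A" "f \<in> A \<times> A \<rightarrow> A" "g \<in> A \<times> A \<rightarrow> A"
  shows "path_sign A (Suc (2 * i)) f g = pair_sign3 A fst snd ^ i * path_sign A (Suc 0) f g"
proof (induction i)
  case (Suc i)
  have "path_sign A (Suc (2 * Suc i)) f g = path_sign A (Suc (Suc (Suc (2 * i)))) f g"
    by simp
  also have "\<dots> = pair_sign3 A fst snd * path_sign A (Suc (2 * i)) f g"
    by (rule path_sign_add_2[OF assms])
  finally show ?case
    by (simp only: Suc.IH power_Suc mult.assoc)
qed simp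

text \<open>Since \<open>S\<close> is symmetric up to \<open>swap_sign A\<close>, the trace of
  \<open>S^2\<close> is that sign times the sum of the squared entries.\<close>

lemma trace_path_sign:
  assumes A: "finite A"
  shows "(\<Sum>f\<in>A \<times> A \<rightarrow>\<^sub>E A. path_sign A (Suc (2 * i)) f f) =
    pair_sign3 A fst snd ^ i * swap_sign A * fact (card (A \<times> A))"
proof -
  let ?W = "A \<times> A \<rightarrow>\<^sub>E A"
  have "(\<Sum>f\<in>?W. path_sign A (Suc (2 * i)) f f) =
      (\<Sum>f\<in>?W. pair_sign3 A fst snd ^ i * (\<Sum>h\<in>?W. swap_sign A * (pair_sign A f h * pair_sign A f h)))"
  proof (rule sum.cong[OF refl])
    fix f assume "f \<in> ?W"
    then have f: "f \<in> A \<times> A \<rightarrow> A" by auto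
    have "path_sign A (Suc 0) f f = (\<Sum>h\<in>?W. pair_sign A f h * pair_sign A h f)"
      by simp
    also have "\<dots> = (\<Sum>h\<in>?W. swap_sign A * (pair_sign A f h * pair_sign A f h))"
    proof (rule sum.cong[OF refl])
      fix h assume "h \<in> ?W"
      then have "h \<in> A \<times> A \<rightarrow> A" by auto
      from pair_sign_swap[OF A f this]
      show "pair_sign A f h * pair_sign A h f = swap_sign A * (pair_sign A f h * pair_sign A f h)"
        by (simp only: mult_ac)
    qed
    finally show "path_sign A (Suc (2 * i)) f f =
        pair_sign3 A fst snd ^ i * (\<Sum>h\<in>?W. swap_sign A * (pair_sign A f h * pair_sign A f h))"
      by (simp only: path_sign_odd[OF A f f])
  qed
  also have "\<dots> = pair_sign3 A fst snd ^ i * swap_sign A * (\<Sum>f\<in>?W. \<Sum>h\<in>?W. pair_sign A f h * pair_sign A f h)"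
    by (simp only: sum_distrib_left mult.assoc)
  finally show ?thesis
    by (simp only: sum_pair_sign_square[OF A])
qed

section \<open>Powers of the matrix as sums over chains of permutations\<close>

lemma sum_of_bool_fun_eq:
  assumes "finite P" "finite A" "u \<in> P \<rightarrow> A"
  shows "(\<Sum>h\<in>P \<rightarrow>\<^sub>E A. of_bool (\<forall>x\<in>P. u x = h x) * of_bool (\<forall>x\<in>P. v x = h x)) =
    (of_bool (\<forall>x\<in>P. u x = v x) :: int)"
proof -
  let ?h = "restrict u P"
  have h: "?h \<in> P \<rightarrow>\<^sub>E A" using assms(3) by auto
  have "(\<Sum>h\<in>P \<rightarrow>\<^sub>E A. of_bool (\<forall>x\<in>P. u x = h x) * of_bool (\<forall>x\<in>P. v x = h x) :: int) =
      (\<Sum>h\<in>P \<rightarrow>\<^sub>E A. if h = ?h then of_bool (\<forall>x\<in>P. u x = v x) else 0)"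
  proof (rule sum.cong[OF refl])
    fix h assume h': "h \<in> P \<rightarrow>\<^sub>E A"
    have iff: "(\<forall>x\<in>P. u x = h x) \<longleftrightarrow> h = ?h"
    proof
      show "h = ?h" if "\<forall>x\<in>P. u x = h x"
        using that by (intro PiE_ext[OF h' h]) simp
      show "\<forall>x\<in>P. u x = h x" if "h = ?h"
        unfolding that by simp
    qed
    have "(\<forall>x\<in>P. v x = h x) \<longleftrightarrow> (\<forall>x\<in>P. u x = v x)" if "\<forall>x\<in>P. u x = h x"
      using that by auto
    then show "of_bool (\<forall>x\<in>P. u x = h x) * of_bool (\<forall>x\<in>P. v x = h x) =
        (if h = ?h then of_bool (\<forall>x\<in>P. u x = v x) else (0 :: int))"
      unfolding iff[symmetric] by simp
  qed
  then show ?thesis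
    using h assms by (simp add: sum.delta finite_PiE)
qed

text \<open>The Kronecker deltas between consecutive modes of a tensor with \<open>m + 1\<close>
  modes, imposed at all positions \<open>x\<close> at once.\<close>

definition linked :: "('a \<times> 'a) set \<Rightarrow> nat \<Rightarrow> (nat \<Rightarrow> 'a \<times> 'a \<Rightarrow> 'a \<times> 'a) \<Rightarrow> bool" where
  "linked P m \<tau> \<longleftrightarrow> (\<forall>x\<in>P. \<forall>k\<in>{1..<Suc m}. snd (\<tau> k x) = fst (\<tau> (k + 1) x))"

text \<open>Each factor of the matrix power contributes one permutation, and summing over an
  intermediate index \<open>h\<close> glues the second component of one to the first component of
  the next. The induction appends the new permutation as component \<open>m + 2\<close>.\<close>

lemma path_sign_eq_sum:
  fixes A :: "'a set"
  assumes A: "finite A"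
  shows "path_sign A m f g = (\<Sum>\<tau>\<in>{1..Suc m} \<rightarrow>\<^sub>E {\<sigma>. \<sigma> permutes A \<times> A}.
    (\<Prod>k=1..Suc m. sign (\<tau> k)) * of_bool ((\<forall>x\<in>A \<times> A. fst (\<tau> 1 x) = f x) \<and> linked (A \<times> A) m \<tau> \<and>
      (\<forall>x\<in>A \<times> A. snd (\<tau> (Suc m) x) = g x)))"
proof (induction m arbitrary: g)
  case 0
  have "{1..Suc 0} = insert 1 {}" by auto
  then show ?case
    by (simp add: sum_PiE_insert pair_sign_eq_sum_permutes[OF A] linked_def ball_conj_distrib)
next
  case (Suc m)
  let ?S = "{\<sigma>. \<sigma> permutes A \<times> A}" and ?W = "A \<times> A \<rightarrow>\<^sub>E A"
  define T where "T = {1..Suc m} \<rightarrow>\<^sub>E ?S"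
  define s where "s \<tau> = (\<Prod>k=1..Suc m. sign (\<tau> k))" for \<tau> :: "nat \<Rightarrow> 'a \<times> 'a \<Rightarrow> 'a \<times> 'a"
  define B where "B \<tau> \<longleftrightarrow> (\<forall>x\<in>A \<times> A. fst (\<tau> 1 x) = f x) \<and> linked (A \<times> A) m \<tau>"
    for \<tau> :: "nat \<Rightarrow> 'a \<times> 'a \<Rightarrow> 'a \<times> 'a"
  have IH: "path_sign A m f h = (\<Sum>\<tau>\<in>T. s \<tau> * of_bool (B \<tau>) * of_bool (\<forall>x\<in>A \<times> A. snd (\<tau> (Suc m) x) = h x))" for h
    unfolding Suc.IH T_def s_def B_def by (simp add: of_bool_conj mult.assoc)
  have "path_sign A (Suc m) f g = (\<Sum>h\<in>?W. \<Sum>\<tau>\<in>T. \<Sum>\<sigma>\<in>?S.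
      (s \<tau> * of_bool (B \<tau>) * (sign \<sigma> * of_bool (\<forall>x\<in>A \<times> A. snd (\<sigma> x) = g x))) *
      (of_bool (\<forall>x\<in>A \<times> A. snd (\<tau> (Suc m) x) = h x) * of_bool (\<forall>x\<in>A \<times> A. fst (\<sigma> x) = h x)))"
    unfolding path_sign.simps IH pair_sign_eq_sum_permutes[OF A] sum_product
    by (simp add: ball_conj_distrib of_bool_conj mult_ac)
  also have "\<dots> = (\<Sum>\<tau>\<in>T. \<Sum>\<sigma>\<in>?S. \<Sum>h\<in>?W.
      (s \<tau> * of_bool (B \<tau>) * (sign \<sigma> * of_bool (\<forall>x\<in>A \<times> A. snd (\<sigma> x) = g x))) *
      (of_bool (\<forall>x\<in>A \<times> A. snd (\<tau> (Suc m) x) = h x) * of_bool (\<forall>x\<in>A \<times> A. fst (\<sigma> x) = h x)))"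
    by (subst sum.swap, rule sum.cong[OF refl], rule sum.swap)
  also have "\<dots> = (\<Sum>\<tau>\<in>T. \<Sum>\<sigma>\<in>?S.
      (s \<tau> * of_bool (B \<tau>) * (sign \<sigma> * of_bool (\<forall>x\<in>A \<times> A. snd (\<sigma> x) = g x))) *
      of_bool (\<forall>x\<in>A \<times> A. snd (\<tau> (Suc m) x) = fst (\<sigma> x)))"
    unfolding sum_distrib_left[symmetric]
  proof (intro sum.cong refl arg_cong2[where f = "(*)"] sum_of_bool_fun_eq)
    fix \<tau> assume "\<tau> \<in> T"
    then have "\<tau> (Suc m) permutes A \<times> A" by (auto simp: T_def)
    then show "(\<lambda>x. snd (\<tau> (Suc m) x)) \<in> A \<times> A \<rightarrow> A"
      using permutes_in_image by (fastforce simp: mem_Times_iff)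
  qed (use A in auto)
  also have "\<dots> = (\<Sum>\<sigma>\<in>?S. \<Sum>\<tau>\<in>T.
      (s \<tau> * of_bool (B \<tau>) * (sign \<sigma> * of_bool (\<forall>x\<in>A \<times> A. snd (\<sigma> x) = g x))) *
      of_bool (\<forall>x\<in>A \<times> A. snd (\<tau> (Suc m) x) = fst (\<sigma> x)))"
    by (rule sum.swap)
  also have "\<dots> = (\<Sum>\<sigma>\<in>?S. \<Sum>\<tau>\<in>T. (\<Prod>k=1..Suc (Suc m). sign ((\<tau>(Suc (Suc m) := \<sigma>)) k)) *
      of_bool ((\<forall>x\<in>A \<times> A. fst ((\<tau>(Suc (Suc m) := \<sigma>)) 1 x) = f x) \<and>
        linked (A \<times> A) (Suc m) (\<tau>(Suc (Suc m) := \<sigma>)) \<and>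
        (\<forall>x\<in>A \<times> A. snd ((\<tau>(Suc (Suc m) := \<sigma>)) (Suc (Suc m)) x) = g x)))"
  proof (rule sum.cong[OF refl], rule sum.cong[OF refl])
    fix \<sigma> :: "'a \<times> 'a \<Rightarrow> 'a \<times> 'a" and \<tau> :: "nat \<Rightarrow> 'a \<times> 'a \<Rightarrow> 'a \<times> 'a"
    let ?\<tau> = "\<tau>(Suc (Suc m) := \<sigma>)"
    have 1: "(\<Prod>k=1..Suc (Suc m). sign (?\<tau> k)) = s \<tau> * sign \<sigma>"
      unfolding s_def by (subst prod.cl_ivl_Suc) (auto intro!: prod.cong)
    have "{1..<Suc (Suc m)} = insert (Suc m) {1..<Suc m}" by auto
    then have 2: "linked (A \<times> A) (Suc m) ?\<tau> \<longleftrightarrow>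
        linked (A \<times> A) m \<tau> \<and> (\<forall>x\<in>A \<times> A. snd (\<tau> (Suc m) x) = fst (\<sigma> x))"
      unfolding linked_def by auto
    show "(s \<tau> * of_bool (B \<tau>) * (sign \<sigma> * of_bool (\<forall>x\<in>A \<times> A. snd (\<sigma> x) = g x))) *
      of_bool (\<forall>x\<in>A \<times> A. snd (\<tau> (Suc m) x) = fst (\<sigma> x)) = (\<Prod>k=1..Suc (Suc m). sign (?\<tau> k)) *
      of_bool ((\<forall>x\<in>A \<times> A. fst (?\<tau> 1 x) = f x) \<and> linked (A \<times> A) (Suc m) ?\<tau> \<and>
        (\<forall>x\<in>A \<times> A. snd (?\<tau> (Suc (Suc m)) x) = g x))"
      unfolding 1 2 B_def by (simp add: of_bool_conj mult_ac)
  qed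
  also have "\<dots> = (\<Sum>\<tau>\<in>insert (Suc (Suc m)) {1..Suc m} \<rightarrow>\<^sub>E ?S. (\<Prod>k=1..Suc (Suc m). sign (\<tau> k)) *
      of_bool ((\<forall>x\<in>A \<times> A. fst (\<tau> 1 x) = f x) \<and> linked (A \<times> A) (Suc m) \<tau> \<and>
        (\<forall>x\<in>A \<times> A. snd (\<tau> (Suc (Suc m)) x) = g x)))"
    unfolding T_def by (rule sum_PiE_insert[symmetric]) simp
  also have "insert (Suc (Suc m)) {1..Suc m} = {1..Suc (Suc m)}"
    by auto
  finally show ?case .
qed

text \<open>Summing over the common end point \<open>f\<close> closes the chain; this closing
  condition is the delta contributed by the identity matrix in the tensor.\<close>

lemma trace_path_sign_eq_sum:
  fixes A :: "'a set"
  assumes A: "finite A"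
  shows "(\<Sum>f\<in>A \<times> A \<rightarrow>\<^sub>E A. path_sign A m f f) = (\<Sum>\<tau>\<in>{1..Suc m} \<rightarrow>\<^sub>E {\<sigma>. \<sigma> permutes A \<times> A}.
    (\<Prod>k=1..Suc m. sign (\<tau> k)) * of_bool (linked (A \<times> A) m \<tau> \<and>
      (\<forall>x\<in>A \<times> A. fst (\<tau> 1 x) = snd (\<tau> (Suc m) x))))"
proof -
  let ?S = "{\<sigma>. \<sigma> permutes A \<times> A}" and ?W = "A \<times> A \<rightarrow>\<^sub>E A"
  have "(\<Sum>f\<in>?W. path_sign A m f f) = (\<Sum>\<tau>\<in>{1..Suc m} \<rightarrow>\<^sub>E ?S. \<Sum>f\<in>?W.
      ((\<Prod>k=1..Suc m. sign (\<tau> k)) * of_bool (linked (A \<times> A) m \<tau>)) *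
      (of_bool (\<forall>x\<in>A \<times> A. fst (\<tau> 1 x) = f x) * of_bool (\<forall>x\<in>A \<times> A. snd (\<tau> (Suc m) x) = f x)))"
    unfolding path_sign_eq_sum[OF A]
    by (subst sum.swap) (simp add: of_bool_conj mult_ac)
  also have "\<dots> = (\<Sum>\<tau>\<in>{1..Suc m} \<rightarrow>\<^sub>E ?S. ((\<Prod>k=1..Suc m. sign (\<tau> k)) * of_bool (linked (A \<times> A) m \<tau>)) *
      of_bool (\<forall>x\<in>A \<times> A. fst (\<tau> 1 x) = snd (\<tau> (Suc m) x)))"
    unfolding sum_distrib_left[symmetric]
  proof (intro sum.cong refl arg_cong2[where f = "(*)"] sum_of_bool_fun_eq)
    fix \<tau> assume "\<tau> \<in> {1..Suc m} \<rightarrow>\<^sub>E ?S"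
    then have "\<tau> 1 permutes A \<times> A" by auto
    then show "(\<lambda>x. fst (\<tau> 1 x)) \<in> A \<times> A \<rightarrow> A"
      using permutes_in_image by (fastforce simp: mem_Times_iff)
  qed (use A in auto)
  finally show ?thesis
    by (simp only: of_bool_conj mult.assoc)
qed

subsection \<open>The hyperdeterminant\<close>

text \<open>The range assumption places the entry of \<open>1\<^sub>m n\<close> inside the matrix,
  where it is a Kronecker delta.\<close>

lemma imm_tensor_eq_of_bool:
  assumes "d \<ge> 1" "\<And>k. k \<in> {1..d} \<Longrightarrow> p k \<in> {..<n} \<times> {..<n}"
  shows "imm_tensor d n p =
    (of_bool ((\<forall>k\<in>{1..<d}. snd (p k) = fst (p (k + 1))) \<and> fst (p 1) = snd (p d)) :: 'a::comm_ring_1)"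
proof -
  have "p 1 \<in> {..<n} \<times> {..<n}" "p d \<in> {..<n} \<times> {..<n}"
    using assms by auto
  moreover have "(\<Prod>k=1..<d. if snd (p k) = fst (p (k + 1)) then 1 else 0 :: 'a) =
      of_bool (\<forall>k\<in>{1..<d}. snd (p k) = fst (p (k + 1)))"
    by (simp add: prod_of_bool flip: of_bool_def)
  ultimately show ?thesis
    by (auto simp: imm_tensor_def shifted_imm_tensor_def mem_Times_iff)
qed

text \<open>Conjugating every permutation by \<open>b\<close> preserves its sign and turns positions
  into elements of \<open>P\<close>, which removes the numbering from the formula.\<close>

lemma hyperdet_conjugate:
  assumes b: "bij_betw b {0..<N} P"
  shows "hyperdet d N b (X :: ('i, 'a::field_char_0) hypermatrix) = 1 / fact N *
    (\<Sum>\<tau>\<in>{1..d} \<rightarrow>\<^sub>E {\<sigma>. \<sigma> permutes P}. (\<Prod>k=1..d. of_int (sign (\<tau> k))) * (\<Prod>x\<in>P. X (\<lambda>k\<in>{1..d}. \<tau> k x)))"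
proof -
  let ?I = "{0..<N}"
  define c where "c = inv_into ?I b"
  have c: "bij_betw c P ?I" and bc: "\<And>x. x \<in> P \<Longrightarrow> b (c x) = x" and cb: "\<And>i. i \<in> ?I \<Longrightarrow> c (b i) = i"
    using b by (auto simp: c_def bij_betw_inv_into bij_betw_inv_into_right bij_betw_inv_into_left)
  have inj: "inj_on b ?I" using b by (simp add: bij_betw_def)
  have "(\<Sum>\<sigma>\<in>{1..d} \<rightarrow>\<^sub>E {\<sigma>. \<sigma> permutes ?I}. (\<Prod>k=1..d. of_int (sign (\<sigma> k))) *
        (\<Prod>i=0..<N. X (\<lambda>k\<in>{1..d}. b (\<sigma> k i)))) =
      (\<Sum>\<tau>\<in>{1..d} \<rightarrow>\<^sub>E {\<sigma>. \<sigma> permutes P}. (\<Prod>k=1..d. of_int (sign (\<tau> k))) * (\<Prod>x\<in>P. X (\<lambda>k\<in>{1..d}. \<tau> k x)))"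
  proof (rule sum.reindex_bij_witness[where j = "\<lambda>\<sigma>. \<lambda>k\<in>{1..d}. map_permutation ?I b (\<sigma> k)"
        and i = "\<lambda>\<tau>. \<lambda>k\<in>{1..d}. map_permutation P c (\<tau> k)"])
    fix \<sigma> assume \<sigma>: "\<sigma> \<in> {1..d} \<rightarrow>\<^sub>E {\<sigma>. \<sigma> permutes ?I}"
    then have perm: "\<sigma> k permutes ?I" if "k \<in> {1..d}" for k
      using that by auto
    show "(\<lambda>k\<in>{1..d}. map_permutation P c ((\<lambda>k\<in>{1..d}. map_permutation ?I b (\<sigma> k)) k)) = \<sigma>"
    proof
      fix k
      show "(\<lambda>k\<in>{1..d}. map_permutation P c ((\<lambda>k\<in>{1..d}. map_permutation ?I b (\<sigma> k)) k)) k = \<sigma> k"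
        using map_permutation_compose_inv[OF b perm cb, of k] PiE_arb[OF \<sigma>, of k] by auto
    qed
    show "(\<lambda>k\<in>{1..d}. map_permutation ?I b (\<sigma> k)) \<in> {1..d} \<rightarrow>\<^sub>E {\<sigma>. \<sigma> permutes P}"
      using map_permutation_permutes[OF b perm] by auto
    have "(\<Prod>x\<in>P. X (\<lambda>k\<in>{1..d}. (\<lambda>k\<in>{1..d}. map_permutation ?I b (\<sigma> k)) k x)) =
        (\<Prod>i\<in>?I. X (\<lambda>k\<in>{1..d}. (\<lambda>k\<in>{1..d}. map_permutation ?I b (\<sigma> k)) k (b i)))"
      by (rule prod.reindex_bij_betw[OF b, symmetric])
    also have "\<dots> = (\<Prod>i\<in>?I. X (\<lambda>k\<in>{1..d}. b (\<sigma> k i)))"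
    proof (intro prod.cong refl arg_cong[where f = X] restrict_ext)
      fix i k assume "i \<in> ?I" "k \<in> {1..d}"
      then show "(\<lambda>k\<in>{1..d}. map_permutation ?I b (\<sigma> k)) k (b i) = b (\<sigma> k i)"
        by (simp add: map_permutation_apply[OF inj])
    qed
    moreover have "(\<Prod>k=1..d. of_int (sign ((\<lambda>k\<in>{1..d}. map_permutation ?I b (\<sigma> k)) k)) :: 'a) =
        (\<Prod>k=1..d. of_int (sign (\<sigma> k)))"
      using sign_map_permutation[OF inj perm] by (intro prod.cong refl) simp
    ultimately show "(\<Prod>k=1..d. of_int (sign ((\<lambda>k\<in>{1..d}. map_permutation ?I b (\<sigma> k)) k))) *
        (\<Prod>x\<in>P. X (\<lambda>k\<in>{1..d}. (\<lambda>k\<in>{1..d}. map_permutation ?I b (\<sigma> k)) k x)) =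
        (\<Prod>k=1..d. of_int (sign (\<sigma> k))) * (\<Prod>i=0..<N. X (\<lambda>k\<in>{1..d}. b (\<sigma> k i)))"
      by (simp only:)
  next
    fix \<tau> assume \<tau>: "\<tau> \<in> {1..d} \<rightarrow>\<^sub>E {\<sigma>. \<sigma> permutes P}"
    then have perm: "\<tau> k permutes P" if "k \<in> {1..d}" for k
      using that by auto
    show "(\<lambda>k\<in>{1..d}. map_permutation ?I b ((\<lambda>k\<in>{1..d}. map_permutation P c (\<tau> k)) k)) = \<tau>"
    proof
      fix k
      show "(\<lambda>k\<in>{1..d}. map_permutation ?I b ((\<lambda>k\<in>{1..d}. map_permutation P c (\<tau> k)) k)) k = \<tau> k"
        using map_permutation_compose_inv[OF c perm bc, of k] PiE_arb[OF \<tau>, of k] by auto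
    qed
    show "(\<lambda>k\<in>{1..d}. map_permutation P c (\<tau> k)) \<in> {1..d} \<rightarrow>\<^sub>E {\<sigma>. \<sigma> permutes ?I}"
      using map_permutation_permutes[OF c perm] by auto
  qed
  then show ?thesis
    by (simp only: hyperdet_def)
qed

lemma hyperdet_imm_tensor_eq_trace:
  assumes A: "A = {..<n}" and b: "bij_betw b {0..<N} (A \<times> A)"
  shows "hyperdet (Suc m) N b (imm_tensor (Suc m) n :: (nat \<times> nat, 'a::field_char_0) hypermatrix) =
    1 / fact N * of_int (\<Sum>f\<in>A \<times> A \<rightarrow>\<^sub>E A. path_sign A m f f)"
proof -
  have fin: "finite A" using A by simp
  have "(\<Prod>k=1..Suc m. of_int (sign (\<tau> k))) * (\<Prod>x\<in>A \<times> A. imm_tensor (Suc m) n (\<lambda>k\<in>{1..Suc m}. \<tau> k x)) =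
      (of_int ((\<Prod>k=1..Suc m. sign (\<tau> k)) * of_bool (linked (A \<times> A) m \<tau> \<and>
        (\<forall>x\<in>A \<times> A. fst (\<tau> 1 x) = snd (\<tau> (Suc m) x)))) :: 'a)"
    if \<tau>: "\<tau> \<in> {1..Suc m} \<rightarrow>\<^sub>E {\<sigma>. \<sigma> permutes A \<times> A}" for \<tau>
  proof -
    have "(\<Prod>x\<in>A \<times> A. imm_tensor (Suc m) n (\<lambda>k\<in>{1..Suc m}. \<tau> k x)) =
        (\<Prod>x\<in>A \<times> A. of_bool ((\<forall>k\<in>{1..<Suc m}. snd (\<tau> k x) = fst (\<tau> (k + 1) x)) \<and> fst (\<tau> 1 x) = snd (\<tau> (Suc m) x)) :: 'a)"
    proof (rule prod.cong[OF refl])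
      fix x assume x: "x \<in> A \<times> A"
      have "(\<lambda>k\<in>{1..Suc m}. \<tau> k x) k \<in> {..<n} \<times> {..<n}" if "k \<in> {1..Suc m}" for k
      proof -
        have "\<tau> k permutes A \<times> A" using \<tau> that by auto
        then show ?thesis
          using that x permutes_in_image by (fastforce simp: A)
      qed
      then have "imm_tensor (Suc m) n (\<lambda>k\<in>{1..Suc m}. \<tau> k x) =
          (of_bool ((\<forall>k\<in>{1..<Suc m}. snd ((\<lambda>k\<in>{1..Suc m}. \<tau> k x) k) = fst ((\<lambda>k\<in>{1..Suc m}. \<tau> k x) (k + 1))) \<and>
            fst ((\<lambda>k\<in>{1..Suc m}. \<tau> k x) 1) = snd ((\<lambda>k\<in>{1..Suc m}. \<tau> k x) (Suc m))) :: 'a)"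
        by (intro imm_tensor_eq_of_bool) auto
      then show "imm_tensor (Suc m) n (\<lambda>k\<in>{1..Suc m}. \<tau> k x) =
          (of_bool ((\<forall>k\<in>{1..<Suc m}. snd (\<tau> k x) = fst (\<tau> (k + 1) x)) \<and> fst (\<tau> 1 x) = snd (\<tau> (Suc m) x)) :: 'a)"
        by simp
    qed
    also have "\<dots> = of_bool (linked (A \<times> A) m \<tau> \<and> (\<forall>x\<in>A \<times> A. fst (\<tau> 1 x) = snd (\<tau> (Suc m) x)))"
      using fin by (subst prod_of_bool) (simp_all only: linked_def ball_conj_distrib finite_SigmaI)
    finally show ?thesis
      by (simp only: of_int_mult of_int_prod of_int_of_bool)
  qed
  then show ?thesis
    unfolding hyperdet_conjugate[OF b] trace_path_sign_eq_sum[OF fin] of_int_sum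
    by (intro arg_cong2[where f = "(*)"] refl sum.cong)
qed

text \<open>For fixed \<open>i\<close>, the product over \<open>j\<close> is the quotient
  \<open>(n + i)! / i!\<close>; exchanging the two products gives the stated form.\<close>

lemma of_nat_prod_prod_eq_fact_quotients:
  "of_nat (\<Prod>j<n. \<Prod>i<n. Suc j + i) = (\<Prod>i = 0..<n. fact (n + i) / fact i :: 'a::field_char_0)"
proof -
  have "fact (m + i) = (\<Prod>j<m. of_nat (Suc j + i)) * (fact i :: 'a)" for m i
    by (induction m) (simp_all add: algebra_simps)
  then have "(\<Prod>j<n. of_nat (Suc j + i)) = (fact (n + i) / fact i :: 'a)" for i
    by simp
  then have "(\<Prod>i<n. \<Prod>j<n. of_nat (Suc j + i)) = (\<Prod>i<n. fact (n + i) / fact i :: 'a)"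
    by (intro prod.cong refl)
  moreover have "(\<Prod>i<n. \<Prod>j<n. of_nat (Suc j + i)) = (of_nat (\<Prod>j<n. \<Prod>i<n. Suc j + i) :: 'a)"
    unfolding of_nat_prod by (rule prod.swap)
  ultimately show ?thesis
    by (simp only: lessThan_atLeast0)
qed

theorem theorem1p4:
  fixes d n :: nat and b :: "nat \<Rightarrow> nat \<times> nat"
  assumes "even d" and "d \<ge> 2" and "n \<ge> 1"
    and "bij_betw b {0..<n ^ 2} ({0..<n} \<times> {0..<n})"
  shows "hyperdet d (n ^ 2) b (imm_tensor d n :: (nat \<times> nat, 'a :: field_char_0) hypermatrix)
           = (\<Prod>i = 0..<n. fact (n + i) / fact i) ^ (d div 2 - 1) \<or>
         hyperdet d (n ^ 2) b (imm_tensor d n :: (nat \<times> nat, 'a :: field_char_0) hypermatrix)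
           = - ((\<Prod>i = 0..<n. fact (n + i) / fact i) ^ (d div 2 - 1))"
proof -
  define A where "A = {..<n}"
  define i where "i = d div 2 - 1"
  define Q :: 'a where "Q = (\<Prod>i = 0..<n. fact (n + i) / fact i)"
  have fin: "finite A" and card: "card (A \<times> A) = n ^ 2"
    by (simp_all add: A_def power2_eq_square)
  \<comment> \<open>The power \<open>S^d\<close> then has index \<open>Suc (2 * i)\<close>, the form
    required by the trace formula.\<close>
  have d: "d = Suc (Suc (2 * i))"
    using assms(1,2) by (auto simp: i_def elim!: evenE)
  have b: "bij_betw b {0..<n ^ 2} (A \<times> A)"
    using assms(4) by (simp add: A_def lessThan_atLeast0)
  have c: "pair_sign3 A fst snd = swap_sign A * int (\<Prod>j<n. \<Prod>i<n. Suc j + i)"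
    using pair_sign3_fst_snd[OF A_def] det_power_norm_eq[OF fin, of n] by (simp add: A_def)
  have "hyperdet d (n ^ 2) b (imm_tensor d n :: (nat \<times> nat, 'a) hypermatrix) =
      1 / fact (n ^ 2) * of_int (pair_sign3 A fst snd ^ i * swap_sign A * fact (n ^ 2))"
    unfolding d hyperdet_imm_tensor_eq_trace[OF A_def b] trace_path_sign[OF fin] card ..
  also have "\<dots> = of_int (pair_sign3 A fst snd) ^ i * of_int (swap_sign A)"
    by simp
  also have "of_int (pair_sign3 A fst snd) = of_int (swap_sign A) * Q"
    unfolding c Q_def of_nat_prod_prod_eq_fact_quotients[symmetric] by simp
  \<comment> \<open>One swap sign comes from the trace of \<open>S^2\<close> and one from each of
    the \<open>i\<close> factors \<open>c\<close>.\<close>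
  finally have "hyperdet d (n ^ 2) b (imm_tensor d n :: (nat \<times> nat, 'a) hypermatrix) =
      of_int (swap_sign A) ^ Suc i * Q ^ i"
    by (simp add: power_mult_distrib)
  moreover have "swap_sign A = 1 \<or> swap_sign A = -1"
    using swap_sign_square[of A] by (simp add: zmult_eq_1_iff)
  then have "of_int (swap_sign A) ^ Suc i = (1 :: 'a) \<or> of_int (swap_sign A) ^ Suc i = (-1 :: 'a)"
    by (cases "even (Suc i)") auto
  ultimately show ?thesis
    unfolding i_def[symmetric] Q_def[symmetric] by auto
qed

end
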